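(* Let $N=N_{\underline{\mu},P}=\Gamma_{\underline{\mu},P}\backslash(\mathbb{C}^{2n}\ltimes_\rho\mathbb{C}^{2m})$ be the compact complex solvmanifold of complex dimension $2n+2m$ defined in the context. Then $N$ does not admit any astheno-Kähler metric.
   Context: The manifolds $N_{\underline{\mu},P}$. Let $n,m\ge1$ and let $M\in SL(2m;\mathbb{Z})$ be diagonalizable over $\mathbb{R}$ with $PMP^{-1}=\mathrm{diag}(e^{\lambda},e^{-\lambda},\dots,e^{\lambda},e^{-\lambda})$ for some $\lambda\in\mathbb{R}\setminus\{0\}$ and $P\in GL(2m;\mathbb{R})$. For $w=(w_1,\dots,w_{2n})\in\mathbb{C}^{2n}$ put $\phi(w)=\lambda(w_1+\bar w_2+\dots+w_{2n-1}+\bar w_{2n})$ and let $\rho:\mathbb{C}^{2n}\to GL(2m;\mathbb{C})$, $\rho(w)=\mathrm{diag}(e^{\phi(w)},e^{-\overline{\phi(w)}},\dots,e^{\phi(w)},e^{-\overline{\phi(w)}})$. Consider the semidirect product $\mathbb{C}^{2n}\ltimes_\rho\mathbb{C}^{2m}$, with coordinates $(w_1,\dots,w_{2n},z_1,\dots,z_{2m})$. Let $\underline{\mu}=\mathrm{diag}(\mu_1,\dots,\mu_{2n})$ with $\mu_i=\frac{2k_i\pi}{\lambda}$, $k_i\in\mathbb{Z}\setminus\{0\}$, and put $\Gamma'_{\underline{\mu}}=\mathbb{Z}^{2n}\oplus\sqrt{-1}\,\underline{\mu}\,\mathbb{Z}^{2n}$, $\Gamma''_P=P\mathbb{Z}^{2m}\oplus\sqrt{-1}P\mathbb{Z}^{2m}$,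 $\Gamma_{\underline{\mu},P}=\Gamma'_{\underline{\mu}}\ltimes_\rho\Gamma''_P$, a discrete subgroup of $\mathbb{C}^{2n}\ltimes_\rho\mathbb{C}^{2m}$. The complex structure on the quotient $N_{\underline{\mu},P}$ is the one with global coframe of $(1,0)$-forms $\varphi^i=dw_i$ ($1\le i\le 2n$), $\psi^{2j+1}=e^{-\phi(w)}dz_{2j+1}$, $\psi^{2j+2}=e^{\overline{\phi(w)}}dz_{2j+2}$ ($0\le j\le m-1$). Astheno-Kähler metrics. A Hermitian metric $g$ with fundamental form $\omega(U,V)=g(JU,V)$ on a complex manifold $(X,J)$ of complex dimension $d$ is astheno-Kähler if $\partial\bar\partial\,\omega^{d-2}=0$; here $d=2n+2m$. *)

theory Defs
  imports "HOL-Analysis.Analysis" "HOL-Algebra.Coset" "HOL-Combinatorics.Permutations"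
begin

section \<open>Smooth maps\<close>

text \<open>
  \<open>Ck_on k S f\<close> is used for open \<open>S\<close> in a finite-dimensional space only, where it says that all
  iterated directional derivatives of \<open>f\<close> of order at most \<open>k\<close> exist and are continuous on \<open>S\<close>.
\<close>

primrec Ck_on :: "nat \<Rightarrow> 'a::euclidean_space set \<Rightarrow> ('a \<Rightarrow> 'b::real_normed_vector) \<Rightarrow> bool" where
  "Ck_on 0 S f \<longleftrightarrow> continuous_on S f"
| "Ck_on (Suc k) S f \<longleftrightarrow> (\<forall>x\<in>S. f differentiable at x) \<and>
     (\<forall>v. Ck_on k S (\<lambda>x. frechet_derivative f (at x) v))"

definition smooth_on :: "'a::euclidean_space set \<Rightarrow> ('a \<Rightarrow> 'b::real_normed_vector) \<Rightarrow> bool" where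
  "smooth_on S f \<longleftrightarrow> (\<forall>k. Ck_on k S f)"


section \<open>Complex-valued differential forms on open subsets of complex coordinate space\<close>

text \<open>
  A form of degree \<open>r\<close> at a point is an alternating real-multilinear function of \<open>r\<close> tangent
  vectors. The vectors are passed as a sequence, of which only the entries with index below \<open>r\<close> are
  used; the degree is a separate argument of the operations that depend on it. The complex structure
  of \<open>complex ^ 'k\<close> is multiplication by \<open>\<i>\<close>.
\<close>

type_synonym 'k alt_form = "(nat \<Rightarrow> complex ^ 'k) \<Rightarrow> complex"
type_synonym 'k diff_form = "complex ^ 'k \<Rightarrow> 'k alt_form"

definition wedge :: "nat \<Rightarrow> nat \<Rightarrow> 'k alt_form \<Rightarrow> 'k alt_form \<Rightarrow> 'k alt_form" where
  "wedge r s \<alpha> \<beta> v =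
     (\<Sum>\<sigma> | \<sigma> permutes {..<r + s}.
        of_int (sign \<sigma>) * \<alpha> (\<lambda>i. v (\<sigma> i)) * \<beta> (\<lambda>i. v (\<sigma> (r + i)))) / (fact r * fact s)"

primrec wedge_power :: "'k alt_form \<Rightarrow> nat \<Rightarrow> 'k alt_form" where \<comment> \<open>for \<open>\<omega>\<close> of degree 2\<close>
  "wedge_power \<omega> 0 = (\<lambda>v. 1)"
| "wedge_power \<omega> (Suc p) = wedge 2 (2 * p) \<omega> (wedge_power \<omega> p)"

text \<open>
  The complex-linear and the conjugate-linear part of the real differential of a function, that is
  \<open>\<partial>f\<close> and its conjugate counterpart.
\<close>

definition d10 :: "(complex ^ 'k::finite \<Rightarrow> complex) \<Rightarrow> complex ^ 'k \<Rightarrow> complex ^ 'k \<Rightarrow> complex" where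
  "d10 f x u = (frechet_derivative f (at x) u - \<i> * frechet_derivative f (at x) (\<i> *s u)) / 2"

definition d01 :: "(complex ^ 'k::finite \<Rightarrow> complex) \<Rightarrow> complex ^ 'k \<Rightarrow> complex ^ 'k \<Rightarrow> complex" where
  "d01 f x u = (frechet_derivative f (at x) u + \<i> * frechet_derivative f (at x) (\<i> *s u)) / 2"

definition omit :: "nat \<Rightarrow> (nat \<Rightarrow> 'v) \<Rightarrow> nat \<Rightarrow> 'v" where
  "omit i v = (\<lambda>j. v (if j < i then j else Suc j))"

text \<open>
  The operators on forms of degree \<open>r\<close>: the exterior derivative of \<open>\<alpha>\<close> at \<open>v\<^sub>0, \<dots>, v\<^sub>r\<close> is the
  alternating sum of the derivatives of \<open>\<alpha> (v\<^sub>0, \<dots>, omit v\<^sub>i, \<dots>, v\<^sub>r)\<close> in the direction of the constant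
  field \<open>v\<^sub>i\<close>, and \<open>\<partial>\<close> and its conjugate keep the complex-linear, respectively conjugate-linear, part
  of that derivative. If \<open>\<alpha> = f \<eta>\<close> with \<open>\<eta>\<close> a wedge product of forms \<open>dz\<^sub>i\<close> and their conjugates, this is
  \<open>\<partial>f \<and> \<eta>\<close>, respectively the wedge product of the conjugate-linear part of \<open>df\<close> with \<open>\<eta>\<close>.
\<close>

definition del :: "nat \<Rightarrow> 'k::finite diff_form \<Rightarrow> 'k diff_form" where
  "del r \<alpha> x v = (\<Sum>i\<le>r. (-1) ^ i * d10 (\<lambda>y. \<alpha> y (omit i v)) x (v i))"

definition delbar :: "nat \<Rightarrow> 'k::finite diff_form \<Rightarrow> 'k diff_form" where
  "delbar r \<alpha> x v = (\<Sum>i\<le>r. (-1) ^ i * d01 (\<lambda>y. \<alpha> y (omit i v)) x (v i))"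


section \<open>Hermitian metrics on a complex manifold given by an atlas\<close>

text \<open>
  A chart is a domain \<open>U\<close> together with a coordinate map that is injective on \<open>U\<close> and has an open image.
  A tensor field on the manifold is a family of tensor fields on the images of the charts that is
  compatible with all coordinate changes.
\<close>

type_synonym ('p, 'k) chart = "'p set \<times> ('p \<Rightarrow> complex ^ 'k)"
type_synonym ('p, 'k) metric =
  "('p, 'k) chart \<Rightarrow> complex ^ 'k \<Rightarrow> complex ^ 'k \<Rightarrow> complex ^ 'k \<Rightarrow> real"

definition transition :: "('p, 'k) chart \<Rightarrow> ('p, 'k) chart \<Rightarrow> complex ^ 'k \<Rightarrow> complex ^ 'k" where
  "transition C C' x = snd C' (inv_into (fst C) (snd C) x)"

definition hermitian_metric :: "('p, 'k::finite) chart set \<Rightarrow> ('p, 'k) metric \<Rightarrow> bool" where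
  "hermitian_metric A g \<longleftrightarrow>
     (\<forall>(U, c)\<in>A. \<forall>x\<in>c ` U.
        bilinear (g (U, c) x) \<and>
        (\<forall>u v. g (U, c) x u v = g (U, c) x v u) \<and>
        (\<forall>u. u \<noteq> 0 \<longrightarrow> g (U, c) x u u > 0) \<and>
        (\<forall>u v. g (U, c) x (\<i> *s u) (\<i> *s v) = g (U, c) x u v)) \<and>
     (\<forall>(U, c)\<in>A. \<forall>u v. smooth_on (c ` U) (\<lambda>x. g (U, c) x u v)) \<and>
     (\<forall>(U, c)\<in>A. \<forall>(U', c')\<in>A. \<forall>x\<in>c ` (U \<inter> U'). \<forall>u v.
        let \<tau> = transition (U, c) (U', c'); D = frechet_derivative \<tau> (at x)
        in g (U, c) x u v = g (U', c') (\<tau> x) (D u) (D v))"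

definition fundamental_form :: "('p, 'k::finite) metric \<Rightarrow> ('p, 'k) chart \<Rightarrow> 'k diff_form" where
  "fundamental_form g C x v = complex_of_real (g C x (\<i> *s v 0) (v 1))"

definition astheno_kaehler :: "('p, 'k::finite) chart set \<Rightarrow> ('p, 'k) metric \<Rightarrow> bool" where
  "astheno_kaehler A g \<longleftrightarrow> hermitian_metric A g \<and>
     (\<forall>(U, c)\<in>A. \<forall>x\<in>c ` U. \<forall>v.
        let p = CARD('k) - 2
        in del (2 * p + 1)
             (delbar (2 * p) (\<lambda>y. wedge_power (fundamental_form g (U, c) y) p)) x v = 0)"


section \<open>The solvmanifolds\<close>

text \<open>
  The coordinates \<open>w\<close> are indexed by \<open>'n \<times> bool\<close> and the coordinates \<open>z\<close> by \<open>'m \<times> bool\<close>. The pairs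
  \<open>(i, False)\<close> and \<open>(i, True)\<close> are the odd and the even position, respectively, of the \<open>i\<close>-th block of two.
\<close>

type_synonym ('n, 'm) solv = "(complex ^ ('n \<times> bool)) \<times> (complex ^ ('m \<times> bool))"

definition phi :: "real \<Rightarrow> complex ^ ('n::finite \<times> bool) \<Rightarrow> complex" where
  "phi lam w = of_real lam * (\<Sum>i\<in>UNIV. w $ (i, False) + cnj (w $ (i, True)))"

definition rho :: "real \<Rightarrow> complex ^ ('n::finite \<times> bool)
    \<Rightarrow> complex ^ ('m::finite \<times> bool) ^ ('m \<times> bool)" where
  "rho lam w = (\<chi> i j. if i = j then (if snd i then exp (- cnj (phi lam w)) else exp (phi lam w)) else 0)"

definition solv_group :: "real \<Rightarrow> ('n::finite, 'm::finite) solv monoid" where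
  "solv_group lam =
     \<lparr>carrier = UNIV, monoid.mult = (\<lambda>(w, z) (w', z'). (w + w', z + rho lam w *v z')), one = (0, 0)\<rparr>"

definition lattice_w :: "('n::finite \<times> bool \<Rightarrow> real) \<Rightarrow> (complex ^ ('n \<times> bool)) set" where
  "lattice_w mu =
     {w. \<exists>a b :: int ^ ('n \<times> bool).
         \<forall>i. w $ i = of_int (a $ i) + \<i> * of_real (mu i) * of_int (b $ i)}"

definition lattice_z :: "real ^ ('m::finite \<times> bool) ^ ('m \<times> bool) \<Rightarrow> (complex ^ ('m \<times> bool)) set" where
  "lattice_z P =
     {z. \<exists>a b :: int ^ ('m \<times> bool).
         \<forall>j. z $ j = of_real ((P *v (\<chi> i. of_int (a $ i))) $ j)
                   + \<i> * of_real ((P *v (\<chi> i. of_int (b $ i))) $ j)}"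

definition Gam :: "('n::finite \<times> bool \<Rightarrow> real) \<Rightarrow> real ^ ('m::finite \<times> bool) ^ ('m \<times> bool)
    \<Rightarrow> ('n, 'm) solv set" where
  "Gam mu P = lattice_w mu \<times> lattice_z P"

text \<open>
  The value at \<open>(w, z)\<close> on the tangent vector \<open>(a, b)\<close> of the left-invariant coframe; the components
  at \<open>Inl\<close> are \<open>dw\<^sub>i\<close>, those at \<open>Inr\<close> are \<open>exp (- \<phi>) dz\<^sub>j\<close> for odd positions and \<open>exp (cnj \<phi>) dz\<^sub>j\<close> for even ones.
\<close>

definition coframe :: "real \<Rightarrow> ('n::finite, 'm::finite) solv \<Rightarrow> ('n, 'm) solv
    \<Rightarrow> complex ^ (('n \<times> bool) + ('m \<times> bool))" where
  "coframe lam = (\<lambda>(w, z) (a, b).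
     \<chi> k. case k of
       Inl i \<Rightarrow> a $ i
     | Inr j \<Rightarrow> (if snd j then exp (cnj (phi lam w)) else exp (- phi lam w)) * b $ j)"

definition solvmanifold :: "real \<Rightarrow> ('n::finite \<times> bool \<Rightarrow> real)
    \<Rightarrow> real ^ ('m::finite \<times> bool) ^ ('m \<times> bool) \<Rightarrow> ('n, 'm) solv set set" where
  "solvmanifold lam mu P = rcosets\<^bsub>solv_group lam\<^esub> (Gam mu P)"

text \<open>
  The complex structure of the quotient for which the forms of the coframe have type \<open>(1,0)\<close>: a chart
  is a coordinate map with open image whose inverse lifts to a smooth immersion \<open>s\<close> into the group
  along which the forms of the coframe pull back to complex-linear ones. Points of the quotient are the
  cosets \<open>\<Gamma>x\<close>, so the lifting condition already makes the coordinate map injective.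
\<close>

definition solv_atlas :: "real \<Rightarrow> ('n::finite \<times> bool \<Rightarrow> real)
    \<Rightarrow> real ^ ('m::finite \<times> bool) ^ ('m \<times> bool)
    \<Rightarrow> (('n, 'm) solv set, ('n \<times> bool) + ('m \<times> bool)) chart set" where
  "solv_atlas lam mu P =
     {(U, c). U \<subseteq> solvmanifold lam mu P \<and> open (c ` U) \<and>
        (\<exists>s :: complex ^ (('n \<times> bool) + ('m \<times> bool)) \<Rightarrow> ('n, 'm) solv.
           smooth_on (c ` U) s \<and>
           (\<forall>q\<in>U. Gam mu P #>\<^bsub>solv_group lam\<^esub> s (c q) = q) \<and>
           (\<forall>x\<in>c ` U. let D = frechet_derivative s (at x) in
              inj D \<and> (\<forall>v. coframe lam (s x) (D (\<i> *s v)) = \<i> *s coframe lam (s x) (D v))))}"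

end

theory Submission
  imports Defs
begin

text \<open>
  Each form of the coframe is a multiple of some \<open>dw\<^sub>i\<close> or \<open>dz\<^sub>j\<close> by a nowhere vanishing function, so
  the coordinates \<open>(w, z)\<close> are holomorphic: the universal covering is the standard complex space of
  dimension \<open>d = 2n + 2m\<close>, the lattice acts on it by the affine maps
  \<open>(w, z) \<mapsto> (w\<^sub>0 + w, z\<^sub>0 + \<rho>(w\<^sub>0) z)\<close>, and a Hermitian metric on the quotient is an invariant Hermitian
  metric on this space (\<open>lift_astheno_kaehler\<close>). Let \<open>\<omega>\<close> be its fundamental form and \<open>p = d - 2\<close>.

  The obstruction is the invariant \<open>(1,1)\<close>-form \<open>e\<^bsup>-2 Re \<phi>\<^esup> \<i> dz\<^sub>1 \<and> cnj dz\<^sub>1\<close>, since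
  \<open>\<i>\<close> times its image under the operator \<open>del delbar\<close> is a nonnegative form that does not vanish.
  Pairing with it is the classical argument, which needs
  integration over the quotient. The proof below replaces this integral by an average over translations.

  Evaluate \<open>del delbar \<omega>\<^sup>p = 0\<close> on a frame that omits the fibre coordinate \<open>z\<^sub>1\<close>, namely on
  \<open>e, \<i>e, u\<^sub>1, \<i>u\<^sub>1, \<dots>, u\<^sub>p, \<i>u\<^sub>p\<close>, where \<open>e\<close> is the first base direction and the \<open>u\<^sub>l\<close> are the differences of
  the other base directions with \<open>e\<close> and the fibre directions other than that of \<open>z\<^sub>1\<close>. An element of
  the lattice with \<open>exp \<phi> = 1\<close> acts as a translation. The real span of these translations contains all
  vectors of the frame except \<open>e\<close>: the imaginary periods \<open>\<i> \<mu>\<^sub>i\<close> were chosen to make \<open>exp \<phi> = 1\<close>, on a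
  difference of two real base directions \<open>\<phi>\<close> vanishes, and the fibre lattice spans the fibre. Averaging
  over a basis of periods makes the coefficients of \<open>\<omega>\<^sup>p\<close> invariant under this span, so that only the
  derivative along \<open>e\<close> survives, and the equation becomes \<open>h'' = 0\<close>
  (\<open>del_delbar_of_invariant\<close>), where \<open>h(t)\<close> is the average of \<open>\<omega>\<^sup>p(u\<^sub>1, \<i>u\<^sub>1, \<dots>, u\<^sub>p, \<i>u\<^sub>p)\<close> around the point \<open>t e\<close>.

  This value of \<open>\<omega>\<^sup>p\<close> is positive because \<open>\<omega>\<close> is positive definite and the \<open>u\<^sub>l\<close> are linearly independent over
  the complex numbers (\<open>pfaff_positive\<close>), so \<open>h\<close> is a positive affine function. But translation of the
  base by \<open>N e\<close> acts on the fibre by factors \<open>e\<^bsup>\<lambda>N\<^esup>\<close> and \<open>e\<^bsup>-\<lambda>N\<^esup>\<close> of product one. As the frame omits \<open>z\<^sub>1\<close>,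
  invariance of \<open>\<omega>\<close> multiplies the value above by \<open>e\<^bsup>2\<lambda>N\<^esup>\<close>, and \<open>h(N)\<close> is at most \<open>C e\<^bsup>2\<lambda>N\<^esup>\<close>. Letting \<open>\<lambda>N\<close>
  tend to minus infinity shows that the affine function \<open>h\<close> is zero, a contradiction.
\<close>

section \<open>Powers of a two-form as Pfaffian sums\<close>

text \<open>
  This is \<open>2\<^sup>p p!\<close> times the Pfaffian when \<open>B\<close> is skew-symmetric. Unlike the recursive \<open>wedge_power\<close>, the
  sum treats all index pairs \<open>(2l, 2l + 1)\<close> alike, so these pairs can be permuted freely.
\<close>

definition pfaff :: "nat \<Rightarrow> (nat \<Rightarrow> nat \<Rightarrow> complex) \<Rightarrow> complex" where
  "pfaff p B = (\<Sum>\<sigma> | \<sigma> permutes {..<2 * p}.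
     of_int (sign \<sigma>) * (\<Prod>l<p. B (\<sigma> (2 * l)) (\<sigma> (2 * l + 1))))"

lemma sign_permutes_compose:
  assumes "\<sigma> permutes {..<n::nat}" "\<tau> permutes {..<n}"
  shows "sign (\<sigma> \<circ> \<tau>) = sign \<sigma> * sign \<tau>"
  using assms by (intro sign_compose) (auto intro: permutes_imp_permutation[of "{..<n}"])

text \<open>
  Unfolding the recursion gives a sum over a permutation \<open>\<sigma>\<close> of \<open>2p + 2\<close> indices and a permutation \<open>\<tau>\<close> of
  the last \<open>2p\<close> of them. The summand depends only on the composition of \<open>\<sigma>\<close> with \<open>\<tau>\<close>, so
  each \<open>\<tau>\<close> contributes the same and the factor \<open>(2p)!\<close> in the denominator cancels.
\<close>

lemma wedge_power_eq_pfaff: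
  "wedge_power (\<lambda>v. \<beta> (v 0) (v 1)) p v = pfaff p (\<lambda>i j. \<beta> (v i) (v j)) / 2 ^ p"
proof (induction p arbitrary: v)
  case 0
  show ?case by (simp add: pfaff_def)
next
  case (Suc p)
  define Q where "Q \<sigma> = of_int (sign \<sigma>) *
    (\<Prod>l<Suc p. \<beta> (v (\<sigma> (2 * l))) (v (\<sigma> (2 * l + 1))))" for \<sigma> :: "nat \<Rightarrow> nat"
  define ext where "ext \<tau> = map_permutation {..<2 * p} ((+) 2) \<tau>" for \<tau> :: "nat \<Rightarrow> nat"
  let ?S = "{\<sigma>. \<sigma> permutes {..<2 + 2 * p}}" and ?T = "{\<tau>. \<tau> permutes {..<2 * p}}"
  have ext_perm: "ext \<tau> permutes {..<2 + 2 * p}" if "\<tau> \<in> ?T" for \<tau>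
  proof -
    have "ext \<tau> permutes ((+) 2 ` {..<2 * p})"
      unfolding ext_def using that by (intro map_permutation_permutes) (auto simp: bij_betw_def)
    then show ?thesis by (rule permutes_subset) auto
  qed
  have ext_sign: "sign (ext \<tau>) = sign \<tau>" if "\<tau> \<in> ?T" for \<tau>
    unfolding ext_def using that by (intro sign_map_permutation) auto
  have ext_hi: "ext \<tau> (2 + i) = 2 + \<tau> i" if "i < 2 * p" for \<tau> i
    unfolding ext_def using that by (intro map_permutation_apply) auto
  have ext_lo: "ext \<tau> i = i" if "i < 2" for \<tau> i
    using that by (auto simp: ext_def map_permutation_def restrict_id_def)
  have term_eq: "of_int (sign \<sigma>) * \<beta> (v (\<sigma> 0)) (v (\<sigma> 1)) *
      (of_int (sign \<tau>) * (\<Prod>l<p. \<beta> (v (\<sigma> (2 + \<tau> (2 * l)))) (v (\<sigma> (2 + \<tau> (2 * l + 1))))))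
      = Q (\<sigma> \<circ> ext \<tau>)" if "\<sigma> \<in> ?S" "\<tau> \<in> ?T" for \<sigma> \<tau>
  proof -
    have s: "sign (\<sigma> \<circ> ext \<tau>) = sign \<sigma> * sign \<tau>"
      using that ext_perm ext_sign by (subst sign_permutes_compose[of _ "2 + 2 * p"]) auto
    have "(\<Prod>l<Suc p. \<beta> (v ((\<sigma> \<circ> ext \<tau>) (2 * l))) (v ((\<sigma> \<circ> ext \<tau>) (2 * l + 1))))
        = \<beta> (v (\<sigma> 0)) (v (\<sigma> 1)) *
          (\<Prod>l<p. \<beta> (v (\<sigma> (ext \<tau> (2 + 2 * l)))) (v (\<sigma> (ext \<tau> (2 + (2 * l + 1))))))"
      by (subst prod.lessThan_Suc_shift) (simp add: ext_lo)
    also have "(\<Prod>l<p. \<beta> (v (\<sigma> (ext \<tau> (2 + 2 * l)))) (v (\<sigma> (ext \<tau> (2 + (2 * l + 1))))))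
        = (\<Prod>l<p. \<beta> (v (\<sigma> (2 + \<tau> (2 * l)))) (v (\<sigma> (2 + \<tau> (2 * l + 1)))))"
    proof (intro prod.cong refl)
      fix l assume "l \<in> {..<p}"
      then have "ext \<tau> (2 + 2 * l) = 2 + \<tau> (2 * l)" "ext \<tau> (2 + (2 * l + 1)) = 2 + \<tau> (2 * l + 1)"
        by (intro ext_hi; simp)+
      then show "\<beta> (v (\<sigma> (ext \<tau> (2 + 2 * l)))) (v (\<sigma> (ext \<tau> (2 + (2 * l + 1))))) =
          \<beta> (v (\<sigma> (2 + \<tau> (2 * l)))) (v (\<sigma> (2 + \<tau> (2 * l + 1))))" by (simp only:)
    qed
    finally show ?thesis unfolding Q_def s by simp
  qed
  have "wedge_power (\<lambda>v. \<beta> (v 0) (v 1)) (Suc p) v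
      = (\<Sum>\<sigma>\<in>?S. of_int (sign \<sigma>) * \<beta> (v (\<sigma> 0)) (v (\<sigma> 1)) *
          (pfaff p (\<lambda>i j. \<beta> (v (\<sigma> (2 + i))) (v (\<sigma> (2 + j)))) / 2 ^ p)) / (fact 2 * fact (2 * p))"
    by (simp only: wedge_power.simps wedge_def Suc.IH)
  also have "(\<Sum>\<sigma>\<in>?S. of_int (sign \<sigma>) * \<beta> (v (\<sigma> 0)) (v (\<sigma> 1)) *
          (pfaff p (\<lambda>i j. \<beta> (v (\<sigma> (2 + i))) (v (\<sigma> (2 + j)))) / 2 ^ p))
      = (\<Sum>\<sigma>\<in>?S. \<Sum>\<tau>\<in>?T. Q (\<sigma> \<circ> ext \<tau>)) / 2 ^ p"
    unfolding pfaff_def times_divide_eq_right sum_divide_distrib[symmetric] sum_distrib_left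
    by (intro arg_cong[where f = "\<lambda>x. x / 2 ^ p"] sum.cong refl term_eq)
  also have "(\<Sum>\<sigma>\<in>?S. \<Sum>\<tau>\<in>?T. Q (\<sigma> \<circ> ext \<tau>)) = (\<Sum>\<tau>\<in>?T. \<Sum>\<sigma>\<in>?S. Q (\<sigma> \<circ> ext \<tau>))"
    by (rule sum.swap)
  also have "\<dots> = (\<Sum>\<tau>\<in>?T. \<Sum>\<sigma>\<in>?S. Q \<sigma>)"
    by (intro sum.cong refl sum_permutations_compose_right[symmetric] ext_perm)
  also have "\<dots> = fact (2 * p) * (\<Sum>\<sigma>\<in>?S. Q \<sigma>)"
    by (simp add: card_permutations[OF refl])
  also have "(\<Sum>\<sigma>\<in>?S. Q \<sigma>) = pfaff (Suc p) (\<lambda>i j. \<beta> (v i) (v j))"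
    by (simp add: pfaff_def Q_def)
  finally have "wedge_power (\<lambda>v. \<beta> (v 0) (v 1)) (Suc p) v
      = fact (2 * p) * pfaff (Suc p) (\<lambda>i j. \<beta> (v i) (v j)) / 2 ^ p / (2 * fact (2 * p))"
    by (simp only: fact_2)
  then show ?case by simp
qed

text \<open>
  If the last two indices are orthogonal to all others, only those permutations contribute that map
  some pair \<open>(2l, 2l + 1)\<close> onto the last pair. There are \<open>p + 1\<close> choices of \<open>l\<close> and two orientations; by
  skew-symmetry each of these \<open>2 (p + 1)\<close> classes has the same sum.
\<close>

lemma pfaff_Suc_of_orthogonal_block:
  assumes skew: "\<And>i j. B j i = - B i j"
    and orth: "\<And>i. i < 2 * p \<Longrightarrow> B i (2 * p) = 0" "\<And>i. i < 2 * p \<Longrightarrow> B i (2 * p + 1) = 0"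
  shows "pfaff (Suc p) B = of_nat (2 * Suc p) * B (2 * p) (2 * p + 1) * pfaff p B"
proof -
  define N where "N = 2 * Suc p"
  define S where "S = {\<sigma>. \<sigma> permutes {..<N}}"
  define q where "q \<sigma> = of_int (sign \<sigma>) * (\<Prod>l<Suc p. B (\<sigma> (2 * l)) (\<sigma> (2 * l + 1)))"
    for \<sigma> :: "nat \<Rightarrow> nat"
  define R where "R l = {\<sigma> \<in> S. \<sigma> ` {2 * l, 2 * l + 1} = {2 * p, 2 * p + 1}}" for l
  have finS: "finite S" by (simp add: S_def finite_permutations)
  have R_sub: "R l \<subseteq> S" for l by (auto simp: R_def)
  have diag: "B i i = 0" for i using skew[of i i] by simp
  have top: "B (2 * p) j = 0" "B j (2 * p) = 0" if "j < N" "j \<noteq> 2 * p + 1" for j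
  proof -
    have "j < 2 * p \<or> j = 2 * p" using that by (auto simp: N_def)
    then show "B j (2 * p) = 0" using orth diag by auto
    then show "B (2 * p) j = 0" using skew[of "2 * p" j] by simp
  qed
  have zero: "q \<sigma> = 0" if "\<sigma> \<in> S" "\<sigma> \<notin> (\<Union>l<Suc p. R l)" for \<sigma>
  proof -
    have perm: "\<sigma> permutes {..<N}" using that by (simp add: S_def)
    have "2 * p \<in> \<sigma> ` {..<N}" unfolding permutes_image[OF perm] by (simp add: N_def)
    then obtain i where i: "i < N" "\<sigma> i = 2 * p" by auto
    define l where "l = i div 2"
    have l: "l < Suc p" using i by (auto simp: l_def N_def)
    have not: "\<sigma> ` {2 * l, 2 * l + 1} \<noteq> {2 * p, 2 * p + 1}" using that l by (auto simp: R_def)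
    have lt: "\<sigma> (2 * l) < N" "\<sigma> (2 * l + 1) < N"
      using permutes_in_image[OF perm] l by (auto simp: N_def)
    have "B (\<sigma> (2 * l)) (\<sigma> (2 * l + 1)) = 0"
    proof (cases "even i")
      case True
      then have "i = 2 * l" by (simp add: l_def)
      then have "\<sigma> (2 * l + 1) \<noteq> 2 * p + 1" using not i by auto
      then show ?thesis using top(1)[OF lt(2)] i \<open>i = 2 * l\<close> by simp
    next
      case False
      then have "i = 2 * l + 1" by (simp add: l_def)
      then have "\<sigma> (2 * l) \<noteq> 2 * p + 1" using not i by (auto simp: insert_commute)
      then show ?thesis using top(2)[OF lt(1)] i \<open>i = 2 * l + 1\<close> by simp
    qed
    then have "(\<Prod>l<Suc p. B (\<sigma> (2 * l)) (\<sigma> (2 * l + 1))) = 0"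
      using l by (intro prod_zero) (auto intro!: bexI[of _ l])
    then show ?thesis by (simp only: q_def mult_zero_right)
  qed
  have disj: "R l \<inter> R l' = {}" if "l \<noteq> l'" for l l'
  proof -
    have False if "\<sigma> \<in> R l" "\<sigma> \<in> R l'" for \<sigma>
    proof -
      have inj: "inj \<sigma>" using that by (auto simp: R_def S_def permutes_inj)
      have "\<sigma> ` {2 * l, 2 * l + 1} = \<sigma> ` {2 * l', 2 * l' + 1}"
        using that unfolding R_def by (simp only: mem_Collect_eq)
      then have "{2 * l, 2 * l + 1} = {2 * l', 2 * l' + 1}"
        by (simp only: inj_image_eq_iff[OF inj])
      then have "2 * l \<in> {2 * l', 2 * l' + 1}" "2 * l' \<in> {2 * l, 2 * l + 1}" by blast+
      then show False using \<open>l \<noteq> l'\<close> by auto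
    qed
    then show ?thesis by blast
  qed
  \<comment> \<open>Swapping two whole pairs is an even permutation that only reorders the factors of the product.\<close>
  have shift: "sum q (R l) = sum q (R p)" if "l < Suc p" for l
  proof -
    define T :: "nat \<Rightarrow> nat" where "T = Transposition.transpose (2 * l) (2 * p) \<circ> Transposition.transpose (2 * l + 1) (2 * p + 1)"
    have T_even: "T (2 * j) = 2 * Transposition.transpose l p j" and T_odd: "T (2 * j + 1) = 2 * Transposition.transpose l p j + 1" for j
    proof -
      have "2 * j \<noteq> 2 * a + 1" for a :: nat by presburger
      then show "T (2 * j) = 2 * Transposition.transpose l p j"
        by (auto simp: T_def Transposition.transpose_def)
      have "2 * j + 1 \<noteq> 2 * a" "2 * p + 1 \<noteq> 2 * l" "2 * l + 1 \<noteq> 2 * p" for a :: nat by presburger+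
      then show "T (2 * j + 1) = 2 * Transposition.transpose l p j + 1"
        by (auto simp: T_def Transposition.transpose_def)
    qed
    have T_perm: "T permutes {..<N}"
      unfolding T_def using that by (intro permutes_compose permutes_swap_id) (auto simp: N_def)
    have T_invol: "T \<circ> T = id"
    proof
      fix i :: nat
      have "i = 2 * (i div 2) \<or> i = 2 * (i div 2) + 1" by presburger
      moreover have "(T \<circ> T) (2 * j) = 2 * j" "(T \<circ> T) (2 * j + 1) = 2 * j + 1" for j
        by (simp_all only: comp_apply T_even T_odd transpose_involutory)
      ultimately show "(T \<circ> T) i = id i" by (metis id_apply)
    qed
    have T_sign: "sign T = 1"
      unfolding T_def using that
      by (subst sign_permutes_compose[of _ N]) (auto simp: sign_swap_id N_def intro!: permutes_swap_id)
    have q_T: "q (\<sigma> \<circ> T) = q \<sigma>" if "\<sigma> \<in> S" for \<sigma>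
    proof -
      have "sign (\<sigma> \<circ> T) = sign \<sigma>"
        using that T_perm T_sign by (simp add: sign_permutes_compose[of _ N] S_def)
      moreover have "(\<Prod>j<Suc p. B (\<sigma> (2 * Transposition.transpose l p j)) (\<sigma> (2 * Transposition.transpose l p j + 1)))
          = (\<Prod>j<Suc p. B (\<sigma> (2 * j)) (\<sigma> (2 * j + 1)))"
        using \<open>l < Suc p\<close>
        by (intro prod.permute[of "Transposition.transpose l p" "{..<Suc p}"
              "\<lambda>j. B (\<sigma> (2 * j)) (\<sigma> (2 * j + 1))", symmetric, unfolded comp_def])
          (auto intro!: permutes_swap_id)
      ultimately show ?thesis by (simp only: q_def comp_apply T_even T_odd)
    qed
    have mem: "\<sigma> \<circ> T \<in> R l'" if "\<sigma> \<in> R l''" "{l', l''} = {l, p}" for \<sigma> l' l''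
    proof -
      have "Transposition.transpose l p l' = l''" using that(2) by (auto simp: doubleton_eq_iff)
      then have "T ` {2 * l', 2 * l' + 1} = {2 * l'', 2 * l'' + 1}"
        by (simp only: image_insert image_empty T_even T_odd)
      moreover have "\<sigma> \<circ> T \<in> S" using that T_perm by (auto simp: R_def S_def intro: permutes_compose)
      ultimately show ?thesis using that(1) unfolding R_def by (simp only: image_comp[symmetric] mem_Collect_eq)
    qed
    show ?thesis
    proof (rule sum.reindex_bij_witness[of _ "\<lambda>\<sigma>. \<sigma> \<circ> T" "\<lambda>\<sigma>. \<sigma> \<circ> T"])
      show "\<sigma> \<circ> T \<circ> T = \<sigma>" "\<sigma> \<circ> T \<circ> T = \<sigma>" for \<sigma> :: "nat \<Rightarrow> nat"
        by (simp_all only: comp_assoc T_invol comp_id)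
      show "\<sigma> \<circ> T \<in> R p" if "\<sigma> \<in> R l" for \<sigma>
        using mem[OF that, of p] by (simp add: insert_commute)
      show "\<sigma> \<circ> T \<in> R l" if "\<sigma> \<in> R p" for \<sigma>
        using mem[OF that, of l] by simp
      show "q (\<sigma> \<circ> T) = q \<sigma>" if "\<sigma> \<in> R l" for \<sigma>
        using q_T R_sub that by blast
    qed
  qed
  define F :: "nat \<Rightarrow> nat" where "F = Transposition.transpose (2 * p) (2 * p + 1)"
  let ?T = "{\<tau>. \<tau> permutes {..<2 * p}}"
  have F_perm: "F permutes {..<N}" unfolding F_def by (intro permutes_swap_id) (auto simp: N_def)
  have T_S: "\<tau> permutes {..<N}" if "\<tau> \<in> ?T" for \<tau>
    using that by (auto simp: N_def intro: permutes_subset)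
  have fix_top: "\<tau> (2 * p) = 2 * p" "\<tau> (Suc (2 * p)) = Suc (2 * p)" if "\<tau> \<in> ?T" for \<tau>
    using that by (auto intro: permutes_not_in)
  have F_lo: "F i = i" if "i < 2 * p" for i using that by (auto simp: F_def Transposition.transpose_def)
  have F_top: "F (2 * p) = Suc (2 * p)" "F (Suc (2 * p)) = 2 * p" by (auto simp: F_def)
  have Rp: "R p = ?T \<union> (\<lambda>\<tau>. \<tau> \<circ> F) ` ?T"
  proof (intro equalityI subsetI)
    fix \<sigma> assume s: "\<sigma> \<in> R p"
    have down: "\<tau> \<in> ?T" if "\<tau> permutes {..<N}" "\<tau> (2 * p) = 2 * p" "\<tau> (Suc (2 * p)) = Suc (2 * p)" for \<tau>
    proof -
      have "\<tau> permutes {..<2 * p}"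
      proof (rule permutes_superset[OF that(1)])
        fix x assume "x \<in> {..<N} - {..<2 * p}"
        then have "x = 2 * p \<or> x = Suc (2 * p)" by (auto simp: N_def)
        then show "\<tau> x = x" using that by auto
      qed
      then show ?thesis by simp
    qed
    have perm: "\<sigma> permutes {..<N}" using s by (simp add: R_def S_def)
    have "(\<sigma> (2 * p) = 2 * p \<and> \<sigma> (Suc (2 * p)) = Suc (2 * p)) \<or>
          (\<sigma> (2 * p) = Suc (2 * p) \<and> \<sigma> (Suc (2 * p)) = 2 * p)"
      using s by (auto simp: R_def doubleton_eq_iff)
    then show "\<sigma> \<in> ?T \<union> (\<lambda>\<tau>. \<tau> \<circ> F) ` ?T"
    proof
      assume "\<sigma> (2 * p) = 2 * p \<and> \<sigma> (Suc (2 * p)) = Suc (2 * p)"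
      then show ?thesis using down[OF perm] by blast
    next
      assume a: "\<sigma> (2 * p) = Suc (2 * p) \<and> \<sigma> (Suc (2 * p)) = 2 * p"
      then have "\<sigma> \<circ> F \<in> ?T" using perm F_perm F_top by (intro down permutes_compose) auto
      moreover have "\<sigma> = (\<sigma> \<circ> F) \<circ> F" by (auto simp: F_def)
      ultimately show ?thesis by blast
    qed
  next
    fix \<sigma> assume "\<sigma> \<in> ?T \<union> (\<lambda>\<tau>. \<tau> \<circ> F) ` ?T"
    then obtain \<tau> where \<tau>: "\<tau> \<in> ?T" "\<sigma> = \<tau> \<or> \<sigma> = \<tau> \<circ> F" by blast
    then show "\<sigma> \<in> R p"
      using T_S[OF \<tau>(1)] fix_top[OF \<tau>(1)] F_perm F_top
      by (auto simp: R_def S_def permutes_compose insert_commute)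
  qed
  have q_T: "q \<tau> = B (2 * p) (2 * p + 1) *
      (of_int (sign \<tau>) * (\<Prod>l<p. B (\<tau> (2 * l)) (\<tau> (2 * l + 1))))" if "\<tau> \<in> ?T" for \<tau>
    using fix_top[OF that] by (simp add: q_def)
  \<comment> \<open>Reversing the last pair changes the sign of the permutation and of one factor.\<close>
  have q_F: "q (\<tau> \<circ> F) = q \<tau>" if "\<tau> \<in> ?T" for \<tau>
  proof -
    have s: "sign (\<tau> \<circ> F) = - sign \<tau>"
      using T_S[OF that] F_perm by (simp add: sign_permutes_compose[of _ N]) (simp add: F_def sign_swap_id)
    have "(\<Prod>l<p. B (\<tau> (F (2 * l))) (\<tau> (F (2 * l + 1)))) = (\<Prod>l<p. B (\<tau> (2 * l)) (\<tau> (2 * l + 1)))"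
      by (intro prod.cong refl) (simp add: F_lo)
    then show ?thesis
      using fix_top[OF that] skew[of "Suc (2 * p)" "2 * p"] by (simp add: q_def s F_top)
  qed
  have F_inj: "inj_on (\<lambda>\<tau>. \<tau> \<circ> F) ?T"
  proof (rule inj_on_inverseI[of _ "\<lambda>\<tau>. \<tau> \<circ> F"])
    show "\<tau> \<circ> F \<circ> F = \<tau>" for \<tau> :: "nat \<Rightarrow> nat" by (auto simp: F_def)
  qed
  have F_disj: "?T \<inter> (\<lambda>\<tau>. \<tau> \<circ> F) ` ?T = {}"
  proof -
    have False if "\<tau> \<circ> F \<in> ?T" "\<tau> \<in> ?T" for \<tau>
      using fix_top(1)[OF that(1)] fix_top(2)[OF that(2)] F_top by simp
    then show ?thesis by blast
  qed
  have "sum q (R p) = sum q ?T + sum q ((\<lambda>\<tau>. \<tau> \<circ> F) ` ?T)"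
    unfolding Rp using F_disj by (intro sum.union_disjoint) (auto simp: finite_permutations)
  also have "sum q ((\<lambda>\<tau>. \<tau> \<circ> F) ` ?T) = sum q ?T"
    using q_F by (simp add: sum.reindex[OF F_inj])
  also have "sum q ?T = B (2 * p) (2 * p + 1) * pfaff p B"
    unfolding pfaff_def sum_distrib_left by (intro sum.cong refl q_T)
  finally have sum_Rp: "sum q (R p) = 2 * (B (2 * p) (2 * p + 1) * pfaff p B)" by simp
  have "pfaff (Suc p) B = sum q S" by (simp add: pfaff_def q_def S_def N_def)
  also have "\<dots> = sum q (\<Union>l<Suc p. R l)"
    using finS R_sub zero by (intro sum.mono_neutral_right) auto
  also have "\<dots> = (\<Sum>l<Suc p. sum q (R l))"
    using finS R_sub disj by (intro sum.UNION_disjoint) (auto intro: finite_subset)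
  also have "\<dots> = (\<Sum>l<Suc p. sum q (R p))" by (intro sum.cong refl shift) simp
  also have "\<dots> = of_nat (Suc p) * sum q (R p)" by (simp del: sum.lessThan_Suc)
  finally show ?thesis by (simp add: sum_Rp algebra_simps)
qed

text \<open>
  Every vector occurs in exactly one factor of each product.
\<close>

lemma linear_pfaff_slot:
  fixes \<beta> :: "'v::real_vector \<Rightarrow> 'v \<Rightarrow> complex"
  assumes bil: "bilinear \<beta>" and k: "k < 2 * p"
  shows "linear (\<lambda>x. pfaff p (\<lambda>i j. \<beta> ((v(k := x)) i) ((v(k := x)) j)))"
  unfolding pfaff_def
proof (intro linear_compose_sum ballI)
  fix \<sigma> assume "\<sigma> \<in> {\<sigma>. \<sigma> permutes {..<2 * p}}"
  then have perm: "\<sigma> permutes {..<2 * p}" by simp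
  have inj: "inj \<sigma>" using perm by (rule permutes_inj)
  have "k \<in> \<sigma> ` {..<2 * p}" unfolding permutes_image[OF perm] using k by simp
  then obtain i where i: "i < 2 * p" "\<sigma> i = k" by auto
  define l0 where "l0 = i div 2"
  have l0: "l0 < p" using i by (auto simp: l0_def)
  let ?h = "\<lambda>x l. \<beta> ((v(k := x)) (\<sigma> (2 * l))) ((v(k := x)) (\<sigma> (2 * l + 1)))"
  have fac: "linear (\<lambda>x. ?h x l0)"
  proof (cases "even i")
    case True
    then have "i = 2 * l0" by (simp add: l0_def)
    then have "\<sigma> (2 * l0) = k" "\<sigma> (2 * l0 + 1) \<noteq> k" using i inj by (auto simp: inj_eq)
    then show ?thesis using bil by (simp add: bilinear_def)
  next
    case False
    then have "i = 2 * l0 + 1" by (simp add: l0_def)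
    then have "\<sigma> (2 * l0 + 1) = k" "\<sigma> (2 * l0) \<noteq> k" using i inj by (auto simp: inj_eq)
    then show ?thesis using bil by (simp add: bilinear_def)
  qed
  have other: "?h x l = \<beta> (v (\<sigma> (2 * l))) (v (\<sigma> (2 * l + 1)))" if "l \<in> {..<p} - {l0}" for l x
  proof -
    have "2 * l \<noteq> i \<and> 2 * l + 1 \<noteq> i" using that by (auto simp: l0_def)
    then have "\<sigma> (2 * l) \<noteq> k \<and> \<sigma> (2 * l + 1) \<noteq> k" using i inj by (auto simp: inj_eq)
    then show ?thesis by simp
  qed
  define c where "c = of_int (sign \<sigma>) *
    (\<Prod>l\<in>{..<p} - {l0}. \<beta> (v (\<sigma> (2 * l))) (v (\<sigma> (2 * l + 1))))"
  have "of_int (sign \<sigma>) * (\<Prod>l<p. ?h x l) = c * ?h x l0" for x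
  proof -
    have "(\<Prod>l<p. ?h x l) = ?h x l0 * (\<Prod>l\<in>{..<p} - {l0}. ?h x l)"
      using l0 by (intro prod.remove) auto
    also have "(\<Prod>l\<in>{..<p} - {l0}. ?h x l)
        = (\<Prod>l\<in>{..<p} - {l0}. \<beta> (v (\<sigma> (2 * l))) (v (\<sigma> (2 * l + 1))))"
      by (intro prod.cong refl other)
    finally show ?thesis by (simp only: c_def mult_ac)
  qed
  moreover have "linear (\<lambda>x. c * ?h x l0)"
    using linear_compose[OF fac, of "\<lambda>y. c * y"]
      by (simp add: o_def bounded_linear.linear[OF bounded_linear_mult_right])
  ultimately show "linear (\<lambda>x. of_int (sign \<sigma>) * (\<Prod>l<p. ?h x l))" by (simp only:)
qed

text \<open>
  Composing with the transposition of the two equal slots changes only the sign of each summand.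
\<close>

lemma pfaff_eq_0_if_repeated:
  fixes \<beta> :: "'v \<Rightarrow> 'v \<Rightarrow> complex"
  assumes "j < 2 * p" "k < 2 * p" "j \<noteq> k" "v j = v k"
  shows "pfaff p (\<lambda>i j. \<beta> (v i) (v j)) = 0"
proof -
  define q where "q \<sigma> = of_int (sign \<sigma>) * (\<Prod>l<p. \<beta> (v (\<sigma> (2 * l))) (v (\<sigma> (2 * l + 1))))"
    for \<sigma> :: "nat \<Rightarrow> nat"
  have perm: "Transposition.transpose j k permutes {..<2 * p}" using assms by (intro permutes_swap_id) auto
  have v: "v (Transposition.transpose j k i) = v i" for i using assms by (auto simp: Transposition.transpose_def)
  have "q (Transposition.transpose j k \<circ> \<sigma>) = - q \<sigma>" if "\<sigma> permutes {..<2 * p}" for \<sigma>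
    using that perm assms(3) by (simp add: q_def v sign_permutes_compose[of _ "2 * p"] sign_swap_id)
  then have "sum q {\<sigma>. \<sigma> permutes {..<2 * p}} = - sum q {\<sigma>. \<sigma> permutes {..<2 * p}}"
    by (subst setum_permutations_compose_left[OF perm]) (simp add: sum_negf)
  then show ?thesis by (simp add: pfaff_def q_def)
qed

text \<open>
  By linearity in each slot, the added multiples produce only terms with a repeated vector. This is
  the step of a Gram-Schmidt process that makes all vectors orthogonal to the last pair.
\<close>

lemma pfaff_add_multiples_of_top_pair:
  fixes \<beta> :: "'v::real_vector \<Rightarrow> 'v \<Rightarrow> complex"
  assumes bil: "bilinear \<beta>"
    and low: "\<And>i. i < 2 * p \<Longrightarrow> v' i = v i + a i *\<^sub>R v (2 * p) + b i *\<^sub>R v (2 * p + 1)"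
    and top: "v' (2 * p) = v (2 * p)" "v' (2 * p + 1) = v (2 * p + 1)"
  shows "pfaff (Suc p) (\<lambda>i j. \<beta> (v' i) (v' j)) = pfaff (Suc p) (\<lambda>i j. \<beta> (v i) (v j))"
proof -
  define F where "F u = pfaff (Suc p) (\<lambda>i j. \<beta> (u i) (u j))" for u :: "nat \<Rightarrow> 'v"
  define w where "w n = (\<lambda>i. if i < n then v' i else v i)" for n
  have step: "F (w (Suc n)) = F (w n)" if "n < 2 * p" for n
  proof -
    have lin: "linear (\<lambda>x. F ((w n)(n := x)))"
      unfolding F_def using that by (intro linear_pfaff_slot bil) auto
    have rep: "F ((w n)(n := v k)) = 0" if "k = 2 * p \<or> k = 2 * p + 1" for k
      unfolding F_def
      by (rule pfaff_eq_0_if_repeated[of n _ k]) (use that \<open>n < 2 * p\<close> in \<open>auto simp: w_def\<close>)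
    have "w (Suc n) = (w n)(n := v' n)" by (auto simp: w_def less_Suc_eq)
    then have "F (w (Suc n)) = F ((w n)(n := v n + a n *\<^sub>R v (2 * p) + b n *\<^sub>R v (2 * p + 1)))"
      by (simp only: low[OF that])
    also have "\<dots> = F ((w n)(n := v n))"
      by (simp only: linear_add[OF lin] linear_scale[OF lin] rep simp_thms) simp
    also have "(w n)(n := v n) = w n" by (auto simp: w_def)
    finally show ?thesis .
  qed
  have "F (w n) = F v" if "n \<le> 2 * p" for n
    using that by (induction n) (auto simp: step, simp add: w_def)
  then have "F (w (2 * p)) = F v" by simp
  moreover have "F (w (2 * p)) = F v'"
  proof -
    have eq: "w (2 * p) i = v' i" if "i < 2 * Suc p" for i
    proof -
      have "i < 2 * p \<or> i = 2 * p \<or> i = 2 * p + 1" using that by auto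
      then show ?thesis using top by (auto simp: w_def)
    qed
    show ?thesis
      unfolding F_def pfaff_def
    proof (rule sum.cong[OF refl])
      fix \<sigma> assume "\<sigma> \<in> {\<sigma>. \<sigma> permutes {..<2 * Suc p}}"
      then have perm: "\<sigma> permutes {..<2 * Suc p}" by simp
      have lt: "\<sigma> j < 2 * Suc p" if "j < 2 * Suc p" for j
        using permutes_in_image[OF perm, of j] that by simp
      have eq': "w (2 * p) (\<sigma> (2 * l)) = v' (\<sigma> (2 * l))"
          "w (2 * p) (\<sigma> (2 * l + 1)) = v' (\<sigma> (2 * l + 1))" if "l \<in> {..<Suc p}" for l
        using that by (auto intro!: eq[OF lt])
      have "(\<Prod>l<Suc p. \<beta> (w (2 * p) (\<sigma> (2 * l))) (w (2 * p) (\<sigma> (2 * l + 1))))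
          = (\<Prod>l<Suc p. \<beta> (v' (\<sigma> (2 * l))) (v' (\<sigma> (2 * l + 1))))"
        by (rule prod.cong[OF refl]) (simp only: eq')
      then show "of_int (sign \<sigma>) * (\<Prod>l<Suc p. \<beta> (w (2 * p) (\<sigma> (2 * l))) (w (2 * p) (\<sigma> (2 * l + 1))))
          = of_int (sign \<sigma>) * (\<Prod>l<Suc p. \<beta> (v' (\<sigma> (2 * l))) (v' (\<sigma> (2 * l + 1))))"
        by (simp only:)
    qed
  qed
  ultimately show ?thesis by (simp add: F_def)
qed

text \<open>
  The real family \<open>u\<^sub>0, \<i>u\<^sub>0, u\<^sub>1, \<i>u\<^sub>1, \<dots>\<close> of the complex family \<open>u\<close>.
\<close>

definition complex_pairs :: "(nat \<Rightarrow> complex ^ 'k) \<Rightarrow> nat \<Rightarrow> complex ^ 'k" where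
  "complex_pairs u i = (if even i then u (i div 2) else \<i> *s u (i div 2))"

lemma complex_vec_scale: "c *s x = Re c *\<^sub>R x + Im c *\<^sub>R (\<i> *s (x :: complex ^ 'k))"
  by (simp add: vec_eq_iff complex_eq_iff)

locale hermitian_product =
  fixes g :: "complex ^ 'k::finite \<Rightarrow> complex ^ 'k \<Rightarrow> real"
  assumes bil: "bilinear g" and sym: "g x y = g y x"
    and pos: "x \<noteq> 0 \<Longrightarrow> g x x > 0" and J: "g (\<i> *s x) (\<i> *s y) = g x y"
begin

lemma J_left: "g (\<i> *s x) y = - g x (\<i> *s y)"
proof -
  have "\<i> *s (\<i> *s y) = - y" by (simp add: vec_eq_iff)
  then show ?thesis using J[of x "\<i> *s y"] J[of "\<i> *s x" y] bilinear_rneg[OF bil, of "\<i> *s x" y]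
    by simp
qed

lemma J_self: "g x (\<i> *s x) = 0"
  using J_left[of x x] sym[of x "\<i> *s x"] by simp

text \<open>
  A power of a positive definite \<open>(1,1)\<close>-form is positive on complex independent vectors. By
  induction: orthogonalise all vectors against the last one, which changes neither the value nor
  the independence, and split off the last complex pair with \<open>pfaff_Suc_of_orthogonal_block\<close>.
\<close>

lemma pfaff_positive:
  assumes "\<And>c l. (\<Sum>l<p. c l *s u l) = 0 \<Longrightarrow> l < p \<Longrightarrow> c l = 0"
  shows "\<exists>r>0. pfaff p (\<lambda>i j. of_real (g (\<i> *s complex_pairs u i) (complex_pairs u j))) = of_real r"
  using assms
proof (induction p arbitrary: u)
  case 0
  show ?case by (intro exI[of _ 1]) (simp add: pfaff_def)
next
  case (Suc p)
  define \<beta> where "\<beta> x y = complex_of_real (g (\<i> *s x) y)" for x y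
  have lin_i: "linear (\<lambda>x :: complex ^ 'k. \<i> *s x)"
    by (intro linearI) (simp_all add: vec_eq_iff algebra_simps)
  have bil\<beta>: "bilinear \<beta>"
    using bil linear_compose[OF lin_i] unfolding bilinear_def \<beta>_def
    by (auto intro!: linear_compose[unfolded o_def, OF _ bounded_linear.linear[OF bounded_linear_of_real]]
          simp: o_def)
  have skew: "\<beta> y x = - \<beta> x y" for x y
    using J_left[of y x] sym[of y "\<i> *s x"] by (simp add: \<beta>_def)
  define e where "e = u p"
  have "e \<noteq> 0"
  proof
    assume "e = 0"
    then have "(\<Sum>l<Suc p. (if l = p then 1 else 0) *s u l) = 0" by (simp add: e_def if_distrib sum.delta cong: if_cong)
    from Suc.prems[OF this, of p] show False by simp
  qed
  then have ee: "g e e > 0" by (rule pos)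
  \<comment> \<open>\<open>c l\<close> is the Hermitian projection coefficient: its two parts make \<open>u l - c l *s e\<close> orthogonal to both
    \<open>e\<close> and \<open>\<i> *s e\<close>.\<close>
  define c where "c l = Complex (g (u l) e / g e e) (g (u l) (\<i> *s e) / g e e)" for l
  define u' where "u' l = (if l < p then u l - c l *s e else u l)" for l
  have u'_low: "u' l = u l - Re (c l) *\<^sub>R e - Im (c l) *\<^sub>R (\<i> *s e)" if "l < p" for l
    using that complex_vec_scale[of "c l" e] by (simp add: u'_def)
  have orth: "g (u' l) e = 0" "g (u' l) (\<i> *s e) = 0" if "l < p" for l
    using ee J_self[of e] sym[of "\<i> *s e" e] J[of e e]
    by (simp_all add: u'_low[OF that] bilinear_lsub[OF bil] bilinear_lmul[OF bil] c_def)
  have indep: "d l = 0" if "(\<Sum>l<p. d l *s u' l) = 0" "l < p" for d l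
  proof -
    define d' where "d' l = (if l = p then - (\<Sum>k<p. d k * c k) else d l)" for l
    have "(\<Sum>l<Suc p. d' l *s u l) = (\<Sum>l<p. d l *s u l) - (\<Sum>k<p. d k * c k) *s e"
      by (simp add: d'_def e_def)
    also have "\<dots> = (\<Sum>l<p. d l *s u' l)"
      by (simp add: vec_eq_iff u'_def sum_distrib_left sum_distrib_right sum_subtractf algebra_simps)
    finally have "d' l = 0" using Suc.prems[of d' l] that by simp
    then show ?thesis using that by (simp add: d'_def)
  qed
  let ?v = "complex_pairs u" and ?v' = "complex_pairs u'"
  have pairs_top: "complex_pairs f (2 * p) = f p" "complex_pairs f (2 * p + 1) = \<i> *s f p"
    for f :: "nat \<Rightarrow> complex ^ 'k" by (auto simp: complex_pairs_def)
  have u'_p: "u' p = e" "u p = e" by (simp_all add: u'_def e_def)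
  have eq: "pfaff (Suc p) (\<lambda>i j. \<beta> (?v' i) (?v' j)) = pfaff (Suc p) (\<lambda>i j. \<beta> (?v i) (?v j))"
  proof (rule pfaff_add_multiples_of_top_pair[OF bil\<beta>])
    show "?v' (2 * p) = ?v (2 * p)" "?v' (2 * p + 1) = ?v (2 * p + 1)"
      by (simp_all only: pairs_top u'_p)
    show "?v' i = ?v i + (if even i then - Re (c (i div 2)) else Im (c (i div 2))) *\<^sub>R ?v (2 * p)
        + (if even i then - Im (c (i div 2)) else - Re (c (i div 2))) *\<^sub>R ?v (2 * p + 1)"
      if "i < 2 * p" for i
    proof -
      have "i div 2 < p" using that by auto
      then show ?thesis
        by (simp only: pairs_top u'_p)
           (auto simp: complex_pairs_def u'_low vec_eq_iff algebra_simps)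
    qed
  qed
  have zero: "\<beta> (?v' i) e = 0" "\<beta> (?v' i) (\<i> *s e) = 0" if "i < 2 * p" for i
  proof -
    have l: "i div 2 < p" using that by auto
    show "\<beta> (?v' i) e = 0" "\<beta> (?v' i) (\<i> *s e) = 0"
      using orth[OF l] by (auto simp: \<beta>_def complex_pairs_def J J_left bilinear_rneg[OF bil])
  qed
  have "pfaff (Suc p) (\<lambda>i j. \<beta> (?v' i) (?v' j))
      = of_nat (2 * Suc p) * \<beta> e (\<i> *s e) * pfaff p (\<lambda>i j. \<beta> (?v' i) (?v' j))"
    using pfaff_Suc_of_orthogonal_block[of "\<lambda>i j. \<beta> (?v' i) (?v' j)" p, OF skew]
    by (simp only: pairs_top u'_p zero simp_thms)
  moreover obtain r where r: "r > 0" "pfaff p (\<lambda>i j. \<beta> (?v' i) (?v' j)) = of_real r"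
    using Suc.IH[of u'] indep by (auto simp: \<beta>_def)
  ultimately have "pfaff (Suc p) (\<lambda>i j. \<beta> (?v i) (?v j)) = of_real (real (2 * Suc p) * g e e * r)"
    by (simp add: eq[unfolded \<beta>_def, symmetric] \<beta>_def J)
  moreover have "real (2 * Suc p) * g e e * r > 0" using r ee by simp
  ultimately show ?case by (auto simp: \<beta>_def)
qed

end

lemma prod_pairs: "(\<Prod>l<p. f (2 * l) * f (2 * l + 1)) = (\<Prod>i<2 * p. f (i :: nat) :: 'a :: comm_monoid_mult)"
  by (induction p) (simp_all add: mult_ac)

lemma pfaff_rescale:
  "pfaff p (\<lambda>i j. c i * c j * B i j) = (\<Prod>i<2 * p. c i) * pfaff p B"
  unfolding pfaff_def sum_distrib_left
proof (rule sum.cong[OF refl])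
  fix \<sigma> assume "\<sigma> \<in> {\<sigma>. \<sigma> permutes {..<2 * p}}"
  then have \<sigma>: "\<sigma> permutes {..<2 * p}" by simp
  have "(\<Prod>l<p. c (\<sigma> (2 * l)) * c (\<sigma> (2 * l + 1))) = (\<Prod>i<2 * p. c (\<sigma> i))"
    by (rule prod_pairs)
  also have "\<dots> = (\<Prod>i<2 * p. c i)"
    using prod.permute[OF \<sigma>, of c] by (simp add: o_def)
  finally show "of_int (sign \<sigma>) * (\<Prod>l<p. c (\<sigma> (2 * l)) * c (\<sigma> (2 * l + 1)) * B (\<sigma> (2 * l)) (\<sigma> (2 * l + 1)))
      = (\<Prod>i<2 * p. c i) * (of_int (sign \<sigma>) * (\<Prod>l<p. B (\<sigma> (2 * l)) (\<sigma> (2 * l + 1))))"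
    by (simp add: prod.distrib)
qed

section \<open>Smooth functions and the type components of their derivatives\<close>

text \<open>
  This holds for functions that are not differentiable, too: \<open>frechet_derivative\<close> selects from the set of
  all derivatives at the point, and this set depends only on the function near the point.
\<close>

lemma frechet_derivative_cong_open:
  assumes "open S" "x \<in> S" "\<And>y. y \<in> S \<Longrightarrow> f y = g y"
  shows "frechet_derivative f (at x) = frechet_derivative g (at x)"
proof -
  have "(f has_derivative f') (at x) \<longleftrightarrow> (g has_derivative f') (at x)" for f'
    using assms has_derivative_transform_within_open[of f f' x UNIV S g]
      has_derivative_transform_within_open[of g f' x UNIV S f] by auto
  then show ?thesis by (simp add: frechet_derivative_def)
qed

lemma Ck_on_Suc_imp: "Ck_on (Suc k) S f \<Longrightarrow> Ck_on k S f"
proof (induction k arbitrary: f)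
  case 0
  then show ?case
    by (auto intro!: continuous_at_imp_continuous_on differentiable_imp_continuous_within)
next
  case (Suc k)
  then show ?case by auto
qed

lemma Ck_on_cong:
  assumes "open S" "\<And>y. y \<in> S \<Longrightarrow> f y = g y" "Ck_on k S f"
  shows "Ck_on k S g"
  using assms(2,3)
proof (induction k arbitrary: f g)
  case 0
  then show ?case using continuous_on_cong by force
next
  case (Suc k)
  have "g differentiable at x" if "x \<in> S" for x
  proof -
    have "f differentiable at x" using Suc.prems(2) that by simp
    then obtain D where "(f has_derivative D) (at x)" unfolding differentiable_def by blast
    then have "(g has_derivative D) (at x)"
      using assms(1) that Suc.prems(1) by (rule has_derivative_transform_within_open)
    then show ?thesis by (auto simp: differentiable_def)
  qed
  moreover have "Ck_on k S (\<lambda>x. frechet_derivative g (at x) v)" for v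
  proof (rule Suc.IH)
    show "Ck_on k S (\<lambda>x. frechet_derivative f (at x) v)" using Suc.prems by simp
    show "frechet_derivative f (at x) v = frechet_derivative g (at x) v" if "x \<in> S" for x
      using frechet_derivative_cong_open[OF assms(1) that, of f g] Suc.prems by simp
  qed
  ultimately show ?case by simp
qed

lemma Ck_on_local:
  assumes "\<And>x. x \<in> S \<Longrightarrow> \<exists>T. open T \<and> x \<in> T \<and> Ck_on k T f"
  shows "Ck_on k S f"
  using assms
proof (induction k arbitrary: f)
  case 0
  have "isCont f x" if x: "x \<in> S" for x
  proof -
    obtain T where "open T" "x \<in> T" "continuous_on T f" using "0"[OF x] by auto
    then show ?thesis using continuous_on_eq_continuous_at by blast
  qed
  then show ?case by (simp add: continuous_at_imp_continuous_on)
next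
  case (Suc k)
  have "f differentiable at x" if "x \<in> S" for x using Suc.prems[OF that] by auto
  moreover have "Ck_on k S (\<lambda>x. frechet_derivative f (at x) v)" for v
  proof (rule Suc.IH)
    fix x assume "x \<in> S"
    then obtain T where "open T" "x \<in> T" "Ck_on (Suc k) T f" using Suc.prems by blast
    then show "\<exists>T. open T \<and> x \<in> T \<and> Ck_on k T (\<lambda>x. frechet_derivative f (at x) v)"
      by (intro exI[of _ T]) simp
  qed
  ultimately show ?case by simp
qed

lemma Ck_on_const: "Ck_on k S (\<lambda>x. c)"
  by (induction k arbitrary: c) auto

lemma Ck_on_bounded_linear_comp:
  assumes "open S" "bounded_linear L" "Ck_on k S f"
  shows "Ck_on k S (\<lambda>x. L (f x))"
  using assms(3)
proof (induction k arbitrary: f)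
  case 0
  then show ?case using bounded_linear.continuous_on[OF assms(2)] by auto
next
  case (Suc k)
  have der: "((\<lambda>x. L (f x)) has_derivative (\<lambda>v. L (frechet_derivative f (at x) v))) (at x)"
    if "x \<in> S" for x
    using Suc.prems that
    by (intro bounded_linear.has_derivative[OF assms(2)]) (auto simp: frechet_derivative_works)
  have "Ck_on k S (\<lambda>x. frechet_derivative (\<lambda>x. L (f x)) (at x) v)" for v
  proof (rule Ck_on_cong[OF assms(1)])
    show "Ck_on k S (\<lambda>x. L (frechet_derivative f (at x) v))" using Suc by auto
  qed (simp add: frechet_derivative_at[OF der, symmetric])
  then show ?case using der by (auto simp: differentiable_def)
qed

lemma Ck_on_add:
  assumes "open S" "Ck_on k S f" "Ck_on k S g"
  shows "Ck_on k S (\<lambda>x. f x + g x)"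
  using assms(2,3)
proof (induction k arbitrary: f g)
  case 0
  then show ?case by (auto intro: continuous_on_add)
next
  case (Suc k)
  have der: "((\<lambda>x. f x + g x) has_derivative
      (\<lambda>v. frechet_derivative f (at x) v + frechet_derivative g (at x) v)) (at x)" if "x \<in> S" for x
    using Suc.prems that by (intro has_derivative_add) (auto simp: frechet_derivative_works)
  have "Ck_on k S (\<lambda>x. frechet_derivative (\<lambda>x. f x + g x) (at x) v)" for v
  proof (rule Ck_on_cong[OF assms(1)])
    show "Ck_on k S (\<lambda>x. frechet_derivative f (at x) v + frechet_derivative g (at x) v)"
      using Suc by auto
  qed (simp add: frechet_derivative_at[OF der, symmetric])
  then show ?case using der by (auto simp: differentiable_def)
qed

lemma Ck_on_mult:
  fixes f g :: "'a::euclidean_space \<Rightarrow> 'b::real_normed_algebra"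
  assumes "open S" "Ck_on k S f" "Ck_on k S g"
  shows "Ck_on k S (\<lambda>x. f x * g x)"
  using assms(2,3)
proof (induction k arbitrary: f g)
  case 0
  then show ?case by (auto intro: continuous_on_mult)
next
  case (Suc k)
  have der: "((\<lambda>x. f x * g x) has_derivative
      (\<lambda>v. f x * frechet_derivative g (at x) v + frechet_derivative f (at x) v * g x)) (at x)"
    if "x \<in> S" for x
    using Suc.prems that by (intro has_derivative_mult) (auto simp: frechet_derivative_works)
  have "Ck_on k S (\<lambda>x. frechet_derivative (\<lambda>x. f x * g x) (at x) v)" for v
  proof (rule Ck_on_cong[OF assms(1)])
    show "Ck_on k S (\<lambda>x. f x * frechet_derivative g (at x) v + frechet_derivative f (at x) v * g x)"
      using Suc.prems Ck_on_Suc_imp[OF Suc.prems(1)] Ck_on_Suc_imp[OF Suc.prems(2)]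
      by (intro Ck_on_add[OF assms(1)] Suc.IH) auto
  qed (simp add: frechet_derivative_at[OF der, symmetric])
  then show ?case using der by (auto simp: differentiable_def)
qed

lemma smooth_on_const: "smooth_on S (\<lambda>x. c)"
  by (simp add: smooth_on_def Ck_on_const)

lemma smooth_on_add: "open S \<Longrightarrow> smooth_on S f \<Longrightarrow> smooth_on S g \<Longrightarrow> smooth_on S (\<lambda>x. f x + g x)"
  by (simp add: smooth_on_def Ck_on_add)

lemma smooth_on_mult:
  fixes f g :: "'a::euclidean_space \<Rightarrow> 'b::real_normed_algebra"
  shows "open S \<Longrightarrow> smooth_on S f \<Longrightarrow> smooth_on S g \<Longrightarrow> smooth_on S (\<lambda>x. f x * g x)"
  by (simp add: smooth_on_def Ck_on_mult)

lemma smooth_on_bounded_linear_comp: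
  "open S \<Longrightarrow> bounded_linear L \<Longrightarrow> smooth_on S f \<Longrightarrow> smooth_on S (\<lambda>x. L (f x))"
  by (simp add: smooth_on_def Ck_on_bounded_linear_comp)

lemma smooth_on_sum:
  "open S \<Longrightarrow> (\<And>i. i \<in> I \<Longrightarrow> smooth_on S (f i)) \<Longrightarrow> smooth_on S (\<lambda>x. \<Sum>i\<in>I. f i x)"
  by (induction I rule: infinite_finite_induct) (auto intro: smooth_on_const smooth_on_add)

lemma smooth_on_prod:
  fixes f :: "'i \<Rightarrow> 'a::euclidean_space \<Rightarrow> 'b::{real_normed_algebra, comm_ring_1}"
  shows "open S \<Longrightarrow> (\<And>i. i \<in> I \<Longrightarrow> smooth_on S (f i)) \<Longrightarrow> smooth_on S (\<lambda>x. \<Prod>i\<in>I. f i x)"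
  by (induction I rule: infinite_finite_induct) (auto intro: smooth_on_const smooth_on_mult)

lemma smooth_on_bounded_linear:
  assumes "open S" "bounded_linear L"
  shows "smooth_on S L"
proof -
  have "Ck_on k S L" for k
  proof (cases k)
    case 0
    then show ?thesis using bounded_linear.continuous_on[OF assms(2) continuous_on_id] by simp
  next
    case (Suc j)
    have der: "(L has_derivative L) (at x)" for x by (rule bounded_linear_imp_has_derivative[OF assms(2)])
    then show ?thesis
      unfolding Suc by (auto simp: differentiable_def frechet_derivative_at[OF der, symmetric] Ck_on_const)
  qed
  then show ?thesis by (simp add: smooth_on_def)
qed

lemma smooth_Ck: "smooth_on S f \<Longrightarrow> Ck_on k S f"
  by (simp add: smooth_on_def)

text \<open>
  The direction comes first so that \<open>dir_deriv u f\<close> is again a function, to which \<open>smooth_on\<close> and the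
  averages below apply.
\<close>

definition dir_deriv :: "'a::euclidean_space \<Rightarrow> ('a \<Rightarrow> complex) \<Rightarrow> 'a \<Rightarrow> complex" where
  "dir_deriv u f x = frechet_derivative f (at x) u"

lemma smooth_differentiable: "smooth_on UNIV f \<Longrightarrow> f differentiable at x"
  unfolding smooth_on_def using Ck_on.simps(2)[of 0 UNIV f] by blast

lemma smooth_has_derivative:
  "smooth_on UNIV f \<Longrightarrow> (f has_derivative (\<lambda>u. dir_deriv u f x)) (at x)"
  using smooth_differentiable[of f x] by (simp add: frechet_derivative_works dir_deriv_def[abs_def])

lemma smooth_dir_deriv: "smooth_on UNIV f \<Longrightarrow> smooth_on UNIV (dir_deriv u f)"
  unfolding smooth_on_def dir_deriv_def[abs_def] using Ck_on.simps(2) by blast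

lemma smooth_continuous: "smooth_on UNIV f \<Longrightarrow> continuous_on UNIV f"
  unfolding smooth_on_def using Ck_on.simps(1) by blast

lemma dir_deriv_eqI: "(f has_derivative D) (at x) \<Longrightarrow> dir_deriv u f x = D u"
  by (simp add: dir_deriv_def frechet_derivative_at[symmetric])

lemma linear_dir_deriv: "smooth_on UNIV f \<Longrightarrow> linear (\<lambda>u. dir_deriv u f x)"
  using has_derivative_linear[OF smooth_has_derivative] .

lemma frechet_derivative_translate:
  fixes f :: "'a::real_normed_vector \<Rightarrow> 'b::real_normed_vector"
  assumes "\<And>x. f (x + w) = f x"
  shows "frechet_derivative f (at (x + w)) = frechet_derivative f (at x)"
proof -
  have "(f has_derivative D) (at (x + w)) \<longleftrightarrow> (f has_derivative D) (at x)" for D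
  proof
    assume "(f has_derivative D) (at (x + w))"
    moreover have "((\<lambda>x. x + w) has_derivative (\<lambda>x. x)) (at x)"
      by (auto intro!: derivative_eq_intros)
    ultimately show "(f has_derivative D) (at x)"
      using has_derivative_compose[of "\<lambda>x. x + w" "\<lambda>x. x" x UNIV f D] assms by simp
  next
    assume "(f has_derivative D) (at x)"
    moreover have "f (x - w) = f x" for x using assms[of "x - w"] by simp
    moreover have "((\<lambda>x. x - w) has_derivative (\<lambda>x. x)) (at (x + w))"
      by (auto intro!: derivative_eq_intros)
    ultimately show "(f has_derivative D) (at (x + w))"
      using has_derivative_compose[of "\<lambda>x. x - w" "\<lambda>x. x" "x + w" UNIV f D] by simp
  qed
  then show ?thesis by (simp add: frechet_derivative_def)
qed

lemma d10_eq: "d10 f x u = (dir_deriv u f x - \<i> * dir_deriv (\<i> *s u) f x) / 2"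
  and d01_eq: "d01 f x u = (dir_deriv u f x + \<i> * dir_deriv (\<i> *s u) f x) / 2"
  by (simp_all add: d10_def d01_def dir_deriv_def)

lemma smooth_d10: "smooth_on UNIV f \<Longrightarrow> smooth_on UNIV (\<lambda>x. d10 f x u)"
  and smooth_d01: "smooth_on UNIV f \<Longrightarrow> smooth_on UNIV (\<lambda>x. d01 f x u)"
proof -
  assume f: "smooth_on UNIV f"
  have lin: "bounded_linear (\<lambda>z :: complex. c * z)" for c by (rule bounded_linear_mult_right)
  have *: "smooth_on UNIV (\<lambda>x. (1 / 2) * dir_deriv u f x + c * dir_deriv (\<i> *s u) f x)" for c
    by (intro smooth_on_add smooth_on_bounded_linear_comp[OF _ lin] smooth_dir_deriv f) auto
  show "smooth_on UNIV (\<lambda>x. d10 f x u)"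
    using *[of "- \<i> / 2"] by (simp add: d10_eq field_simps)
  show "smooth_on UNIV (\<lambda>x. d01 f x u)"
    using *[of "\<i> / 2"] by (simp add: d01_eq field_simps)
qed

lemma smooth_delbar:
  assumes "\<And>v. smooth_on UNIV (\<lambda>x. W x v)"
  shows "smooth_on UNIV (\<lambda>x. delbar r W x v)"
  unfolding delbar_def
  by (intro smooth_on_sum smooth_on_bounded_linear_comp[OF _ bounded_linear_mult_right] smooth_d01 assms) auto

lemma smooth_pfaff:
  assumes "\<And>i j. smooth_on UNIV (\<lambda>x. B x i j)"
  shows "smooth_on UNIV (\<lambda>x. pfaff p (B x))"
  unfolding pfaff_def
  by (intro smooth_on_sum smooth_on_bounded_linear_comp[OF _ bounded_linear_mult_right] smooth_on_prod assms) auto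

section \<open>Averaging over translations\<close>

definition line_mean :: "'a::euclidean_space \<Rightarrow> ('a \<Rightarrow> complex) \<Rightarrow> 'a \<Rightarrow> complex" where
  "line_mean v f x = integral {0..1} (\<lambda>s. f (x + s *\<^sub>R v))"

text \<open>
  The average over the parallelepiped spanned by \<open>vs\<close>, as an iterated one-dimensional integral. For a
  function with periods \<open>vs\<close> this is the mean over a torus.
\<close>

abbreviation torus_mean :: "'a::euclidean_space list \<Rightarrow> ('a \<Rightarrow> complex) \<Rightarrow> 'a \<Rightarrow> complex" where
  "torus_mean \<equiv> foldr line_mean"

lemma line_mean_integrable:
  fixes f :: "'a::euclidean_space \<Rightarrow> complex"
  assumes "continuous_on UNIV f"
  shows "(\<lambda>s. f (x + s *\<^sub>R v)) integrable_on {0..1::real}"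
  by (intro integrable_continuous_real continuous_on_compose2[OF assms] continuous_intros) auto

lemma continuous_line_mean:
  assumes "continuous_on UNIV f"
  shows "continuous_on UNIV (line_mean v f)"
  unfolding line_mean_def[abs_def] interval_cbox
  by (intro integral_continuous_on_param)
     (auto simp: split_beta intro!: continuous_intros continuous_on_compose2[OF assms])

lemma line_mean_has_derivative:
  assumes f: "Ck_on (Suc 0) UNIV f"
  shows "(line_mean v f has_derivative (\<lambda>u. line_mean v (dir_deriv u f) x)) (at x)"
proof -
  define D where "D y = Blinfun (frechet_derivative f (at y))" for y
  have D: "blinfun_apply (D y) = frechet_derivative f (at y)" for y
    unfolding D_def using f
    by (intro bounded_linear_Blinfun_apply has_derivative_bounded_linear[of f _ "at y"])
       (auto simp: frechet_derivative_works)
  have contD: "continuous_on UNIV D"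
    using f by (intro continuous_on_blinfun_componentwise) (auto simp: D)
  have cont: "continuous_on UNIV f" using Ck_on_Suc_imp[OF f] by simp
  have "((\<lambda>x. integral (cbox 0 1) (\<lambda>s. f (x + s *\<^sub>R v))) has_derivative
      blinfun_apply (integral (cbox 0 1) (\<lambda>s. D (x + s *\<^sub>R v)))) (at x within UNIV)"
  proof (rule leibniz_rule)
    fix y :: 'a and s :: real
    have "(f has_derivative blinfun_apply (D (y + s *\<^sub>R v))) (at (y + s *\<^sub>R v))"
      unfolding D using f by (auto simp: frechet_derivative_works)
    moreover have "((\<lambda>y. y + s *\<^sub>R v) has_derivative (\<lambda>x. x)) (at y)"
      by (auto intro!: derivative_eq_intros)
    ultimately show "((\<lambda>y. f (y + s *\<^sub>R v)) has_derivative blinfun_apply (D (y + s *\<^sub>R v))) (at y within UNIV)"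
      using has_derivative_compose[of "\<lambda>y. y + s *\<^sub>R v" "\<lambda>x. x" y UNIV f] by simp
    show "(\<lambda>s. f (y + s *\<^sub>R v)) integrable_on cbox 0 1"
      using line_mean_integrable[OF cont] by simp
    show "continuous_on (UNIV \<times> cbox 0 1) (\<lambda>(x, s). D (x + s *\<^sub>R v))"
      by (auto simp: split_beta intro!: continuous_intros continuous_on_compose2[OF contD])
  qed auto
  moreover have "blinfun_apply (integral (cbox 0 1) (\<lambda>s. D (x + s *\<^sub>R v)))
      = (\<lambda>u. line_mean v (dir_deriv u f) x)"
  proof
    fix u
    have "(\<lambda>s. D (x + s *\<^sub>R v)) integrable_on cbox 0 (1::real)"
      by (intro integrable_continuous continuous_on_compose2[OF contD] continuous_intros) auto
    from integral_linear[OF this blinfun.bounded_linear_left[of u]]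
    show "blinfun_apply (integral (cbox 0 1) (\<lambda>s. D (x + s *\<^sub>R v))) u = line_mean v (dir_deriv u f) x"
      by (simp add: o_def D line_mean_def dir_deriv_def)
  qed
  moreover have "line_mean v f = (\<lambda>x. integral (cbox 0 1) (\<lambda>s. f (x + s *\<^sub>R v)))"
    by (simp add: line_mean_def[abs_def])
  ultimately show ?thesis by simp
qed

lemma dir_deriv_line_mean:
  assumes "smooth_on UNIV f"
  shows "dir_deriv u (line_mean v f) = line_mean v (dir_deriv u f)"
  by (intro ext dir_deriv_eqI[OF line_mean_has_derivative] smooth_Ck assms)

lemma smooth_line_mean:
  assumes "smooth_on UNIV f"
  shows "smooth_on UNIV (line_mean v f)"
proof -
  have "Ck_on k UNIV (line_mean v f)" if "smooth_on UNIV f" for k f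
    using that
  proof (induction k arbitrary: f)
    case 0
    then show ?case by (simp add: continuous_line_mean smooth_continuous)
  next
    case (Suc k)
    have "line_mean v f differentiable at x" for x
      using line_mean_has_derivative[OF smooth_Ck[OF Suc.prems]] differentiableI by blast
    moreover have "Ck_on k UNIV (dir_deriv u (line_mean v f))" for u
      unfolding dir_deriv_line_mean[OF Suc.prems] by (rule Suc.IH[OF smooth_dir_deriv[OF Suc.prems]])
    ultimately show ?case by (simp add: dir_deriv_def[abs_def])
  qed
  then show ?thesis using assms by (simp add: smooth_on_def)
qed

lemma line_mean_add:
  assumes "continuous_on UNIV f" "continuous_on UNIV g"
  shows "line_mean v (\<lambda>x. f x + g x) = (\<lambda>x. line_mean v f x + line_mean v g x)"
  unfolding line_mean_def
  by (intro ext integral_add line_mean_integrable assms)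

lemma line_mean_cmult: "line_mean v (\<lambda>x. c * f x) = (\<lambda>x. c * line_mean v f x)"
  unfolding line_mean_def by (intro ext) (rule integral_mult_right)

lemma line_mean_periodic:
  assumes "\<And>x. f (x + w) = f x"
  shows "line_mean v f (x + w) = line_mean v f x"
proof -
  have "f (x + w + s *\<^sub>R v) = f (x + s *\<^sub>R v)" for s
    using assms[of "x + s *\<^sub>R v"] by (simp add: algebra_simps)
  then show ?thesis by (simp add: line_mean_def)
qed

text \<open>
  By the fundamental theorem of calculus the integral is \<open>f (x + v) - f x\<close>.
\<close>

lemma line_mean_dir_deriv_eq_0:
  assumes "smooth_on UNIV f" "\<And>x. f (x + v) = f x"
  shows "line_mean v (dir_deriv v f) x = 0"
proof -
  have "((\<lambda>s. f (x + s *\<^sub>R v)) has_vector_derivative dir_deriv v f (x + s *\<^sub>R v)) (at s within {0..1})" for s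
  proof -
    have "((\<lambda>s. x + s *\<^sub>R v) has_derivative (\<lambda>t. t *\<^sub>R v)) (at s within {0..1})"
      by (auto intro!: derivative_eq_intros)
    from has_derivative_compose[OF this smooth_has_derivative[OF assms(1)]]
    show ?thesis
      by (simp add: has_vector_derivative_def linear_scale[OF linear_dir_deriv[OF assms(1)]])
  qed
  then have "((\<lambda>s. dir_deriv v f (x + s *\<^sub>R v)) has_integral (f (x + 1 *\<^sub>R v) - f (x + 0 *\<^sub>R v))) {0..1}"
    by (intro fundamental_theorem_of_calculus) auto
  then show ?thesis using assms(2) by (simp add: line_mean_def integral_unique)
qed

lemma smooth_torus_mean: "smooth_on UNIV f \<Longrightarrow> smooth_on UNIV (torus_mean vs f)"
  by (induction vs) (auto simp: smooth_line_mean)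

lemma dir_deriv_torus_mean:
  "smooth_on UNIV f \<Longrightarrow> dir_deriv u (torus_mean vs f) = torus_mean vs (dir_deriv u f)"
  by (induction vs) (auto simp: dir_deriv_line_mean smooth_torus_mean)

lemma continuous_torus_mean: "continuous_on UNIV f \<Longrightarrow> continuous_on UNIV (torus_mean vs f)"
  by (induction vs) (auto simp: continuous_line_mean)

lemma torus_mean_cmult: "torus_mean vs (\<lambda>x. c * f x) = (\<lambda>x. c * torus_mean vs f x)"
  by (induction vs) (auto simp: line_mean_cmult)

lemma torus_mean_0: "torus_mean vs (\<lambda>x. 0) = (\<lambda>x. 0)"
  using torus_mean_cmult[of vs 0 "\<lambda>x. 0"] by simp

lemma torus_mean_add:
  assumes "continuous_on UNIV f" "continuous_on UNIV g"
  shows "torus_mean vs (\<lambda>x. f x + g x) = (\<lambda>x. torus_mean vs f x + torus_mean vs g x)"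
  using assms by (induction vs) (auto simp: line_mean_add continuous_torus_mean)

lemma torus_mean_sum:
  assumes "\<And>i. i \<in> I \<Longrightarrow> continuous_on UNIV (f i)"
  shows "torus_mean vs (\<lambda>x. \<Sum>i\<in>I. f i x) = (\<lambda>x. \<Sum>i\<in>I. torus_mean vs (f i) x)"
  using assms
  by (induction I rule: infinite_finite_induct)
     (auto simp: torus_mean_0 torus_mean_add continuous_on_sum)

lemma torus_mean_periodic:
  "(\<And>x. f (x + w) = f x) \<Longrightarrow> torus_mean vs f (x + w) = torus_mean vs f x"
  by (induction vs arbitrary: x) (auto intro: line_mean_periodic)

text \<open>
  The average in one period kills the derivative along it, and the averages in the other periods
  commute with that derivative. Linearity of the derivative extends this to the real span.
\<close>

lemma dir_deriv_torus_mean_eq_0: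
  assumes "smooth_on UNIV f" "\<And>w x. w \<in> set vs \<Longrightarrow> f (x + w) = f x" "u \<in> span (set vs)"
  shows "dir_deriv u (torus_mean vs f) x = 0"
proof -
  have *: "dir_deriv w (torus_mean us f) = (\<lambda>x. 0)" if "w \<in> set us" "set us \<subseteq> set vs" for w us
    using that
  proof (induction us)
    case (Cons v us)
    have sm: "smooth_on UNIV (torus_mean us f)" by (rule smooth_torus_mean[OF assms(1)])
    show ?case
    proof (cases "w = v")
      case True
      have "torus_mean us f (x + v) = torus_mean us f x" for x
        using Cons.prems assms(2) by (intro torus_mean_periodic) auto
      then show ?thesis
        using True line_mean_dir_deriv_eq_0[OF sm] by (auto simp: dir_deriv_line_mean[OF sm])
    next
      case False
      then show ?thesis
        using Cons torus_mean_0[of "[v]"] by (simp add: dir_deriv_line_mean[OF sm])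
    qed
  qed simp
  show ?thesis
    by (rule span_induct[OF assms(3)])
       (use * linear_subspace_kernel[OF linear_dir_deriv[OF smooth_torus_mean[OF assms(1)]]] in auto)
qed

text \<open>
  The derivative along the segment from \<open>x\<close> to \<open>x + u\<close> vanishes.
\<close>

lemma torus_mean_invariant:
  assumes "smooth_on UNIV f" "\<And>w x. w \<in> set vs \<Longrightarrow> f (x + w) = f x" "u \<in> span (set vs)"
  shows "torus_mean vs f (x + u) = torus_mean vs f x"
proof -
  have sm: "smooth_on UNIV (torus_mean vs f)" by (rule smooth_torus_mean[OF assms(1)])
  have "((\<lambda>s. torus_mean vs f (x + s *\<^sub>R u)) has_derivative (\<lambda>t. 0)) (at s within {0..1})" for s
  proof -
    have "((\<lambda>s. x + s *\<^sub>R u) has_derivative (\<lambda>t. t *\<^sub>R u)) (at s within {0..1})"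
      by (auto intro!: derivative_eq_intros)
    from has_derivative_compose[OF this smooth_has_derivative[OF sm]]
    show ?thesis
      by (simp add: linear_scale[OF linear_dir_deriv[OF sm]] dir_deriv_torus_mean_eq_0[OF assms])
  qed
  then obtain c where "\<And>s. s \<in> {0..1::real} \<Longrightarrow> torus_mean vs f (x + s *\<^sub>R u) = c"
    using has_derivative_zero_constant[of "{0..1::real}" "\<lambda>s. torus_mean vs f (x + s *\<^sub>R u)"] by auto
  from this[of 0] this[of 1] show ?thesis by simp
qed

lemma norm_torus_mean_le:
  assumes "continuous_on UNIV f" "\<And>y. y \<in> span (set vs) \<Longrightarrow> norm (f (x + y)) \<le> C"
  shows "norm (torus_mean vs f x) \<le> C"
  using assms(2)
proof (induction vs arbitrary: x)
  case Nil
  then show ?case by (auto dest: spec[of _ 0])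
next
  case (Cons v vs)
  have "norm (torus_mean vs f (x + s *\<^sub>R v)) \<le> C" for s
  proof (rule Cons.IH)
    fix y assume "y \<in> span (set vs)"
    then have "s *\<^sub>R v + y \<in> span (set (v # vs))"
      using span_mono[of "set vs" "set (v # vs)"] by (intro span_add span_scale) (auto intro: span_base)
    then show "norm (f (x + s *\<^sub>R v + y)) \<le> C" using Cons.prems[of "s *\<^sub>R v + y"] by (simp add: add.assoc)
  qed
  then have "norm (integral {0..1} (\<lambda>s. torus_mean vs f (x + s *\<^sub>R v))) \<le> C * (1 - 0)"
    by (intro integral_bound continuous_on_compose2[OF continuous_torus_mean[OF assms(1)]] continuous_intros) auto
  then have "norm (line_mean v (torus_mean vs f) x) \<le> C"
    unfolding line_mean_def[of v "torus_mean vs f" x] by simp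
  then show ?case by simp
qed

lemma Re_torus_mean_pos:
  assumes "continuous_on UNIV f" "\<And>x. Re (f x) > 0"
  shows "Re (torus_mean vs f x) > 0"
proof (induction vs arbitrary: x)
  case Nil
  then show ?case using assms by simp
next
  case (Cons v vs)
  let ?g = "\<lambda>s. torus_mean vs f (x + s *\<^sub>R v)"
  have cont: "continuous_on {0..1} (\<lambda>s::real. Re (?g s))"
    by (intro continuous_on_Re continuous_on_compose2[OF continuous_torus_mean[OF assms(1)]] continuous_intros) auto
  have "\<exists>s0\<in>{0..1::real}. \<forall>s\<in>{0..1}. Re (?g s0) \<le> Re (?g s)"
    by (rule continuous_attains_inf[OF compact_Icc _ cont]) simp
  then obtain s0 where s0: "\<And>s. s \<in> {0..1} \<Longrightarrow> Re (?g s0) \<le> Re (?g s)" by blast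
  have "?g integrable_on {0..1}"
    by (rule line_mean_integrable[OF continuous_torus_mean[OF assms(1)]])
  from integral_linear[OF this bounded_linear_Re]
  have "Re (line_mean v (torus_mean vs f) x) = integral {0..1} (\<lambda>s. Re (?g s))"
    unfolding line_mean_def[of v "torus_mean vs f" x] by (simp add: o_def)
  then have "Re (torus_mean (v # vs) f x) = integral {0..1} (\<lambda>s. Re (?g s))" by simp
  moreover have "integral {0..1} (\<lambda>s::real. Re (?g s0)) \<le> integral {0..1} (\<lambda>s. Re (?g s))"
    using cont s0 by (intro integral_le integrable_continuous_real) auto
  ultimately show ?case using Cons.IH[of "x + s0 *\<^sub>R v"] by simp
qed

lemma periodic_int_multiple:
  fixes f :: "'a::real_vector \<Rightarrow> 'b"
  assumes "\<And>x. f (x + w) = f x"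
  shows "f (x + of_int n *\<^sub>R w) = f x"
proof (induction n rule: int_induct[where k = 0])
  case base
  then show ?case by simp
next
  case (step1 i)
  then show ?case using assms[of "x + of_int i *\<^sub>R w"] by (simp add: algebra_simps)
next
  case (step2 i)
  then show ?case using assms[of "x + of_int (i - 1) *\<^sub>R w"] by (simp add: algebra_simps)
qed

text \<open>
  Periodicity reduces all coefficients to the interval from 0 to 1, hence the argument to a compact ball.
\<close>

lemma periodic_bounded_on_span:
  fixes f :: "'a::euclidean_space \<Rightarrow> complex"
  assumes "finite B" "continuous_on UNIV f" "\<And>w x. w \<in> B \<Longrightarrow> f (x + w) = f x"
  shows "\<exists>C. \<forall>y\<in>span B. norm (f y) \<le> C"
proof -
  define R where "R = (\<Sum>w\<in>B. norm w)"
  have "compact (f ` cball 0 R)"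
    by (intro compact_continuous_image continuous_on_subset[OF assms(2)]) auto
  then obtain C where C: "\<And>y. y \<in> cball 0 R \<Longrightarrow> norm (f y) \<le> C"
    using compact_imp_bounded by (force simp: bounded_iff)
  have "norm (f y) \<le> C" if "y \<in> span B" for y
  proof -
    obtain r where y: "y = (\<Sum>w\<in>B. r w *\<^sub>R w)" using \<open>y \<in> span B\<close> span_finite[OF assms(1)] by auto
    define y' where "y' = (\<Sum>w\<in>B. frac (r w) *\<^sub>R w)"
    have shift: "f (x + (\<Sum>w\<in>A. of_int \<lfloor>r w\<rfloor> *\<^sub>R w)) = f x" if "A \<subseteq> B" for A x
      using finite_subset[OF that assms(1)] that
    proof (induction A arbitrary: x rule: finite_induct)
      case (insert w A)
      then show ?case
        using periodic_int_multiple[of f w "x + (\<Sum>w\<in>A. of_int \<lfloor>r w\<rfloor> *\<^sub>R w)" "\<lfloor>r w\<rfloor>"] assms(3)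
        by (simp add: add_ac)
    qed simp
    have "y = y' + (\<Sum>w\<in>B. of_int \<lfloor>r w\<rfloor> *\<^sub>R w)"
      by (simp add: y y'_def frac_def sum.distrib[symmetric] scaleR_add_left[symmetric])
    then have "f y = f y'" using shift[of B y'] by simp
    moreover have "norm y' \<le> R"
      unfolding y'_def R_def
    proof (rule sum_norm_le)
      fix w
      have "norm (frac (r w) *\<^sub>R w) = frac (r w) * norm w" by (simp add: frac_ge_0)
      also have "\<dots> \<le> norm w"
        using frac_lt_1[of "r w"] by (intro mult_left_le_one_le) (auto simp: frac_ge_0)
      finally show "norm (frac (r w) *\<^sub>R w) \<le> norm w" .
    qed
    ultimately show ?thesis using C by simp
  qed
  then show ?thesis by blast
qed

lemma affine_along_line:
  assumes sm: "smooth_on UNIV f" and zero: "\<And>x. dir_deriv e (dir_deriv e f) x = 0"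
  shows "f (t *\<^sub>R e) = f 0 + of_real t * dir_deriv e f 0"
proof -
  have der: "((\<lambda>s. g (s *\<^sub>R e)) has_vector_derivative dir_deriv e g (s *\<^sub>R e)) (at s)"
    if "smooth_on UNIV g" for g :: "'a \<Rightarrow> complex" and s
  proof -
    have "((\<lambda>s. s *\<^sub>R e) has_derivative (\<lambda>t. t *\<^sub>R e)) (at s)"
      by (auto intro!: derivative_eq_intros)
    from has_derivative_compose[OF this smooth_has_derivative[OF that]]
    show ?thesis by (simp add: has_vector_derivative_def linear_scale[OF linear_dir_deriv[OF that]])
  qed
  have const: "q t = q 0" if "\<And>s. (q has_vector_derivative 0) (at s)" for q :: "real \<Rightarrow> complex" and t
  proof -
    have "\<exists>c. \<forall>x\<in>UNIV. q x = c"
      using that by (intro has_derivative_zero_constant) (auto simp: has_vector_derivative_def)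
    then show ?thesis by auto
  qed
  have "dir_deriv e f (s *\<^sub>R e) = dir_deriv e f 0" for s
    using const[of "\<lambda>s. dir_deriv e f (s *\<^sub>R e)" s] der[OF smooth_dir_deriv[OF sm, of e]] by (simp add: zero)
  then have "((\<lambda>s. f (s *\<^sub>R e) - of_real s * dir_deriv e f 0) has_vector_derivative 0) (at s)" for s
    using der[OF sm, of s] by (auto intro!: derivative_eq_intros)
  from const[OF this, of t] show ?thesis by (simp add: algebra_simps)
qed

text \<open>
  The difference of consecutive terms tends to \<open>b\<close> and to 0, so \<open>b = 0\<close> and the terms are constantly \<open>a\<close>.
\<close>

lemma affine_decay:
  fixes a b :: complex
  assumes "\<And>n. norm (a + of_nat n * b) \<le> C * q ^ n" "0 \<le> q" "q < 1"
  shows "a = 0"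
proof -
  have "(\<lambda>n. C * q ^ n) \<longlonglongrightarrow> C * 0"
    by (intro tendsto_mult_left LIMSEQ_power_zero) (simp add: assms(2,3))
  then have "(\<lambda>n. C * q ^ n) \<longlonglongrightarrow> 0" by simp
  then have lim: "(\<lambda>n. a + of_nat n * b) \<longlonglongrightarrow> 0"
    by (rule Lim_null_comparison[OF always_eventually[OF allI[OF assms(1)]]])
  have "(\<lambda>n. (a + of_nat (Suc n) * b) - (a + of_nat n * b)) \<longlonglongrightarrow> 0 - 0"
    by (intro tendsto_diff LIMSEQ_Suc[OF lim] lim)
  then have "(\<lambda>n::nat. b) \<longlonglongrightarrow> 0" by (simp add: algebra_simps)
  then have "b = 0" by (simp add: LIMSEQ_const_iff)
  then show ?thesis using lim by (simp add: LIMSEQ_const_iff)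
qed

section \<open>The operators on averaged and on partially invariant forms\<close>

lemma torus_mean_d10:
  assumes "smooth_on UNIV f"
  shows "torus_mean vs (\<lambda>x. d10 f x u) = (\<lambda>x. d10 (torus_mean vs f) x u)"
    and "torus_mean vs (\<lambda>x. d01 f x u) = (\<lambda>x. d01 (torus_mean vs f) x u)"
proof -
  have *: "torus_mean vs (\<lambda>x. a * dir_deriv u f x + b * dir_deriv w f x)
      = (\<lambda>x. a * dir_deriv u (torus_mean vs f) x + b * dir_deriv w (torus_mean vs f) x)" for a b w
    using assms
    by (simp add: torus_mean_add torus_mean_cmult dir_deriv_torus_mean continuous_on_mult_left
        smooth_continuous smooth_dir_deriv)
  show "torus_mean vs (\<lambda>x. d10 f x u) = (\<lambda>x. d10 (torus_mean vs f) x u)"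
    using *[of "1 / 2" "- \<i> / 2" "\<i> *s u"] by (simp add: d10_eq field_simps)
  show "torus_mean vs (\<lambda>x. d01 f x u) = (\<lambda>x. d01 (torus_mean vs f) x u)"
    using *[of "1 / 2" "\<i> / 2" "\<i> *s u"] by (simp add: d01_eq field_simps)
qed

lemma del_torus_mean:
  assumes "\<And>v. smooth_on UNIV (\<lambda>x. W x v)"
  shows "del r (\<lambda>y v. torus_mean vs (\<lambda>x. W x v) y) x v = torus_mean vs (\<lambda>x. del r W x v) x"
    and "delbar r (\<lambda>y v. torus_mean vs (\<lambda>x. W x v) y) x v = torus_mean vs (\<lambda>x. delbar r W x v) x"
  using assms
  by (simp_all add: del_def delbar_def torus_mean_sum continuous_on_mult_left smooth_continuous
      smooth_d10 smooth_d01 torus_mean_cmult torus_mean_d10 eta_contract_eq)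

text \<open>
  All directions except \<open>e\<close> are invisible to \<open>W\<close>, so in the double alternating sum only the first two
  slots can be differentiated. There \<open>del\<close> and \<open>delbar\<close> take half the derivative along \<open>e\<close>, with factors \<open>\<i>\<close> and
  \<open>- \<i>\<close> in the slot of \<open>\<i> *s e\<close>, and the two remaining terms have equal signs.
\<close>

lemma del_delbar_of_invariant:
  fixes W :: "complex ^ 'k::finite \<Rightarrow> (nat \<Rightarrow> complex ^ 'k) \<Rightarrow> complex"
  assumes sm: "\<And>v. smooth_on UNIV (\<lambda>x. W x v)"
    and V: "subspace V"
    and inv: "\<And>x u v. u \<in> V \<Longrightarrow> W (x + u) v = W x v"
    and e: "v 0 = e" "v 1 = \<i> *s e" "\<i> *s e \<in> V"
    and rest: "\<And>i. i \<ge> 2 \<Longrightarrow> i < r + 2 \<Longrightarrow> v i \<in> V \<and> \<i> *s v i \<in> V"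
  shows "del (Suc r) (delbar r W) x v
       = - \<i> / 2 * dir_deriv e (dir_deriv e (\<lambda>y. W y (\<lambda>i. v (i + 2)))) x"
proof -
  have zero: "dir_deriv u f y = 0"
    if "smooth_on UNIV f" "\<And>x u. u \<in> V \<Longrightarrow> f (x + u) = f x" "u \<in> V" for f u y
  proof -
    have "((\<lambda>s. y + s *\<^sub>R u) has_derivative (\<lambda>t. t *\<^sub>R u)) (at (0::real))"
      by (auto intro!: derivative_eq_intros)
    moreover have "(f has_derivative (\<lambda>u. dir_deriv u f y)) (at (y + 0 *\<^sub>R u))"
      using smooth_has_derivative[OF that(1)] by simp
    ultimately have "((\<lambda>s. f (y + s *\<^sub>R u)) has_derivative (\<lambda>t. dir_deriv (t *\<^sub>R u) f y)) (at (0::real))"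
      by (rule has_derivative_compose)
    moreover have "(\<lambda>s. f (y + s *\<^sub>R u)) = (\<lambda>s. f y)"
      using that(2) subspace_scale[OF V that(3)] by auto
    ultimately have "((\<lambda>s::real. f y) has_derivative (\<lambda>t. dir_deriv (t *\<^sub>R u) f y)) (at 0)" by simp
    then have "(\<lambda>t::real. dir_deriv (t *\<^sub>R u) f y) = (\<lambda>t. 0)"
      by (rule has_derivative_unique) (rule has_derivative_const)
    from fun_cong[OF this, of 1] show ?thesis by simp
  qed
  have ie: "dir_deriv (\<i> *s (\<i> *s e)) f y = - dir_deriv e f y" if "smooth_on UNIV f" for f y
  proof -
    have "\<i> *s (\<i> *s e) = - e" by (simp add: vec_eq_iff)
    then show ?thesis using linear_neg[OF linear_dir_deriv[OF that], of e] by simp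
  qed
  have inv_delbar: "delbar r W (x + u) w = delbar r W x w" if "u \<in> V" for x u w
  proof -
    have "frechet_derivative (\<lambda>y. W y w') (at (x + u)) = frechet_derivative (\<lambda>y. W y w') (at x)" for w'
      using inv[OF that] by (intro frechet_derivative_translate) simp
    then show ?thesis by (simp add: delbar_def d01_def)
  qed
  note smb = smooth_delbar[of W r, OF sm]
  let ?f = "\<lambda>y. W y (\<lambda>i. v (i + 2))"
  have split: "{..Suc r} = insert 0 (insert 1 {2..<r + 2})" by auto
  have high: "d10 (\<lambda>y. delbar r W y (omit i v)) x (v i) = 0" if "i \<in> {2..<r + 2}" for i
    using that rest[of i] zero[OF smb inv_delbar] by (simp add: d10_eq)
  have first: "delbar r W y w = d01 (\<lambda>y. W y (omit 0 w)) y (w 0)"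
    if "\<And>j. 0 < j \<Longrightarrow> j \<le> r \<Longrightarrow> w j = v (Suc j)" for y w
  proof -
    have "d01 (\<lambda>y. W y (omit j w)) y (w j) = 0" if "j \<in> {1..<Suc r}" for j
    proof -
      have "w j \<in> V" "\<i> *s w j \<in> V" using that \<open>\<And>j. 0 < j \<Longrightarrow> j \<le> r \<Longrightarrow> w j = v (Suc j)\<close>[of j] rest[of "Suc j"] by auto
      then show ?thesis using zero[OF sm inv] by (simp add: d01_eq)
    qed
    moreover have "{..r} = insert 0 {1..<Suc r}" by auto
    ultimately show ?thesis by (simp add: delbar_def)
  qed
  have om: "omit 0 (omit 0 v) = (\<lambda>i. v (i + 2))" "omit 0 (omit 1 v) = (\<lambda>i. v (i + 2))"
    by (auto simp: omit_def)
  have F0: "delbar r W y (omit 0 v) = - \<i> / 2 * dir_deriv e ?f y" for y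
  proof -
    have "delbar r W y (omit 0 v) = d01 ?f y (\<i> *s e)"
      using first[of "omit 0 v" y] e by (simp add: omit_def om[unfolded omit_def])
    also have "\<dots> = - \<i> / 2 * dir_deriv e ?f y"
      using zero[OF sm inv e(3), of "\<lambda>i. v (i + 2)" y] ie[OF sm, of "\<lambda>i. v (i + 2)" y] by (simp add: d01_eq)
    finally show ?thesis .
  qed
  have F1: "delbar r W y (omit 1 v) = 1 / 2 * dir_deriv e ?f y" for y
  proof -
    have "delbar r W y (omit 1 v) = d01 ?f y e"
      using first[of "omit 1 v" y] e om(2) by (simp add: omit_def)
    also have "\<dots> = 1 / 2 * dir_deriv e ?f y"
      using zero[OF sm inv e(3), of "\<lambda>i. v (i + 2)" y] by (simp add: d01_eq)
    finally show ?thesis .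
  qed
  have scale: "dir_deriv e (\<lambda>y. c * dir_deriv e ?f y) x = c * dir_deriv e (dir_deriv e ?f) x" for c
    by (rule dir_deriv_eqI[of _ "\<lambda>u. c * dir_deriv u (dir_deriv e ?f) x"])
       (intro has_derivative_mult_right smooth_has_derivative smooth_dir_deriv sm)
  have D0: "dir_deriv e (\<lambda>y. delbar r W y (omit 0 v)) x = - \<i> / 2 * dir_deriv e (dir_deriv e ?f) x"
    using scale[of "- \<i> / 2"] by (simp only: F0)
  have D1: "dir_deriv e (\<lambda>y. delbar r W y (omit 1 v)) x = 1 / 2 * dir_deriv e (dir_deriv e ?f) x"
    using scale[of "1 / 2"] by (simp only: F1)
  have t0: "d10 (\<lambda>y. delbar r W y (omit 0 v)) x (v 0) = - \<i> / 4 * dir_deriv e (dir_deriv e ?f) x"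
    unfolding d10_eq e(1) D0 zero[OF smb inv_delbar e(3), of "omit 0 v" x, simplified] by simp
  have t1: "d10 (\<lambda>y. delbar r W y (omit 1 v)) x (v 1) = \<i> / 4 * dir_deriv e (dir_deriv e ?f) x"
    unfolding d10_eq e(2) ie[OF smb] D1 using zero[OF smb inv_delbar e(3), of "omit 1 v" x] by simp
  have "del (Suc r) (delbar r W) x v = d10 (\<lambda>y. delbar r W y (omit 0 v)) x (v 0)
      - d10 (\<lambda>y. delbar r W y (omit 1 v)) x (v 1)"
    unfolding del_def split using high by simp
  then show ?thesis unfolding t0 t1 by (simp add: field_simps)
qed

section \<open>The covering group and its affine action\<close>

definition rho_factor :: "real \<Rightarrow> complex ^ ('n::finite \<times> bool) \<Rightarrow> bool \<Rightarrow> complex" where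
  "rho_factor lam w b = (if b then exp (- cnj (phi lam w)) else exp (phi lam w))"

definition deck_lin :: "real \<Rightarrow> complex ^ ('n::finite \<times> bool)
    \<Rightarrow> complex ^ (('n \<times> bool) + ('m::finite \<times> bool)) \<Rightarrow> complex ^ (('n \<times> bool) + ('m \<times> bool))" where
  "deck_lin lam w u = (\<chi> l. case l of Inl i \<Rightarrow> u $ l | Inr j \<Rightarrow> rho_factor lam w (snd j) * u $ l)"

text \<open>
  Left translation by \<open>(w, z)\<close> in the group, in the coordinates of \<open>to_solv\<close>; its linear part is
  \<open>deck_lin lam w\<close>.
\<close>

definition deck :: "real \<Rightarrow> complex ^ ('n::finite \<times> bool) \<Rightarrow> complex ^ ('m::finite \<times> bool)
    \<Rightarrow> complex ^ (('n \<times> bool) + ('m \<times> bool)) \<Rightarrow> complex ^ (('n \<times> bool) + ('m \<times> bool))" where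
  "deck lam w z x = (\<chi> l. case l of Inl i \<Rightarrow> w $ i | Inr j \<Rightarrow> z $ j) + deck_lin lam w x"

definition to_solv :: "complex ^ (('n::finite \<times> bool) + ('m::finite \<times> bool)) \<Rightarrow> ('n, 'm) solv" where
  "to_solv x = (\<chi> i. x $ Inl i, \<chi> j. x $ Inr j)"

lemma rho_mult: "(rho lam w *v z) $ j = rho_factor lam w (snd j) * z $ j"
proof -
  have "(rho lam w *v z) $ j = (\<Sum>k\<in>UNIV. if k = j then rho_factor lam w (snd j) * z $ k else 0)"
    unfolding matrix_vector_mult_def vec_lambda_beta
    by (rule sum.cong[OF refl]) (auto simp: rho_def rho_factor_def)
  then show ?thesis by simp
qed

lemma to_solv_deck: "to_solv (deck lam w z x) = (w, z) \<otimes>\<^bsub>solv_group lam\<^esub> to_solv x"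
  by (simp add: to_solv_def deck_def deck_lin_def solv_group_def vec_eq_iff rho_mult)

lemma phi_add: "phi lam (w + w') = phi lam w + phi lam w'"
  by (simp add: phi_def sum.distrib algebra_simps)

lemma phi_zero [simp]: "phi lam 0 = 0"
  by (simp add: phi_def)

lemma rho_factor_add: "rho_factor lam (w + w') b = rho_factor lam w b * rho_factor lam w' b"
  by (simp add: rho_factor_def phi_add exp_add[symmetric])

lemma rho_factor_zero [simp]: "rho_factor lam 0 b = 1"
  by (simp add: rho_factor_def)

lemma group_solv_group: "group (solv_group lam :: ('n::finite, 'm::finite) solv monoid)"
proof (rule groupI)
  fix x y z :: "('n, 'm) solv"
  show "x \<otimes>\<^bsub>solv_group lam\<^esub> y \<otimes>\<^bsub>solv_group lam\<^esub> z = x \<otimes>\<^bsub>solv_group lam\<^esub> (y \<otimes>\<^bsub>solv_group lam\<^esub> z)"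
    by (simp add: solv_group_def split_beta vec_eq_iff rho_mult rho_factor_add algebra_simps)
  show "\<one>\<^bsub>solv_group lam\<^esub> \<otimes>\<^bsub>solv_group lam\<^esub> x = x"
    by (simp add: solv_group_def split_beta prod_eq_iff vec_eq_iff rho_mult)
  show "\<exists>y\<in>carrier (solv_group lam). y \<otimes>\<^bsub>solv_group lam\<^esub> x = \<one>\<^bsub>solv_group lam\<^esub>"
    by (intro bexI[of _ "(- fst x, - (rho lam (- fst x) *v snd x))"])
       (simp_all add: solv_group_def split_beta)
qed (simp_all add: solv_group_def)

lemma linear_deck_lin: "linear (deck_lin lam w)"
  by (intro linearI) (auto simp: deck_lin_def vec_eq_iff algebra_simps split: sum.split)

lemma deck_has_derivative: "(deck lam w z has_derivative deck_lin lam w) (at x)"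
proof -
  have "bounded_linear (deck_lin lam w)"
    using linear_deck_lin linear_conv_bounded_linear by blast
  then show ?thesis unfolding deck_def[abs_def]
    by (auto intro!: derivative_eq_intros bounded_linear_imp_has_derivative)
qed

lemma deck_0 [simp]: "deck lam 0 0 x = x" "deck_lin lam 0 u = u"
  by (auto simp: deck_def deck_lin_def vec_eq_iff split: sum.split)

lemma linear_to_solv: "linear to_solv"
  by (intro linearI) (auto simp: to_solv_def vec_eq_iff)

lemma inj_to_solv: "inj to_solv"
  by (auto simp: inj_def to_solv_def vec_eq_iff split_sum_all)

lemma del_cong_open:
  assumes "open S" "x \<in> S" "\<And>y v. y \<in> S \<Longrightarrow> \<alpha> y v = \<beta> y v"
  shows "delbar r \<alpha> x v = delbar r \<beta> x v" "del r \<alpha> x v = del r \<beta> x v"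
proof -
  have "frechet_derivative (\<lambda>y. \<alpha> y w) (at x) = frechet_derivative (\<lambda>y. \<beta> y w) (at x)" for w
    by (rule frechet_derivative_cong_open[OF assms(1,2)]) (rule assms(3))
  then show "delbar r \<alpha> x v = delbar r \<beta> x v" "del r \<alpha> x v = del r \<beta> x v"
    by (simp_all add: delbar_def del_def d01_def d10_def)
qed

lemma matrix_inv_left:
  fixes A :: "real ^ 'k ^ 'k"
  assumes "invertible A"
  shows "matrix_inv A ** A = mat 1"
  unfolding matrix_inv_def using assms[unfolded invertible_def] by (rule someI2_ex) blast

lemma of_int_det: "real_of_int (det A) = det (\<chi> i j. real_of_int (A $ i $ j))"
  by (simp add: det_def)

lemma lattice_w_add: "w \<in> lattice_w mu \<Longrightarrow> w' \<in> lattice_w mu \<Longrightarrow> w + w' \<in> lattice_w mu"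
proof -
  assume "w \<in> lattice_w mu" "w' \<in> lattice_w mu"
  then obtain a b a' b' where
    "\<And>i. w $ i = of_int (a $ i) + \<i> * of_real (mu i) * of_int (b $ i)"
    "\<And>i. w' $ i = of_int (a' $ i) + \<i> * of_real (mu i) * of_int (b' $ i)"
    unfolding lattice_w_def by blast
  then show ?thesis unfolding lattice_w_def
    by (intro CollectI exI[of _ "a + a'"] exI[of _ "b + b'"]) (simp add: algebra_simps)
qed

lemma lattice_w_minus: "w \<in> lattice_w mu \<Longrightarrow> - w \<in> lattice_w mu"
proof -
  assume "w \<in> lattice_w mu"
  then obtain a b where "\<And>i. w $ i = of_int (a $ i) + \<i> * of_real (mu i) * of_int (b $ i)"
    unfolding lattice_w_def by blast
  then show ?thesis unfolding lattice_w_def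
    by (intro CollectI exI[of _ "- a"] exI[of _ "- b"]) (simp add: algebra_simps)
qed

abbreviation (input) real_vec :: "int ^ 'k \<Rightarrow> real ^ 'k" where
  "real_vec a \<equiv> (\<chi> i. of_int (a $ i))"

lemma real_vec_add: "real_vec (a + b) = real_vec a + real_vec b"
  and real_vec_minus: "real_vec (- a) = - real_vec a"
  by (simp_all add: vec_eq_iff)

lemma lattice_z_add: "z \<in> lattice_z P \<Longrightarrow> z' \<in> lattice_z P \<Longrightarrow> z + z' \<in> lattice_z P"
proof -
  assume "z \<in> lattice_z P" "z' \<in> lattice_z P"
  then obtain a b a' b' where
    "\<And>j. z $ j = of_real ((P *v real_vec a) $ j) + \<i> * of_real ((P *v real_vec b) $ j)"
    "\<And>j. z' $ j = of_real ((P *v real_vec a') $ j) + \<i> * of_real ((P *v real_vec b') $ j)"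
    unfolding lattice_z_def by blast
  then have "(z + z') $ j = of_real ((P *v real_vec (a + a')) $ j) + \<i> * of_real ((P *v real_vec (b + b')) $ j)" for j
    unfolding real_vec_add matrix_vector_right_distrib by (simp add: algebra_simps)
  then show ?thesis unfolding lattice_z_def by blast
qed

lemma lattice_z_minus: "z \<in> lattice_z P \<Longrightarrow> - z \<in> lattice_z P"
proof -
  assume "z \<in> lattice_z P"
  then obtain a b where
    "\<And>j. z $ j = of_real ((P *v real_vec a) $ j) + \<i> * of_real ((P *v real_vec b) $ j)"
    unfolding lattice_z_def by blast
  moreover have neg: "P *v (- x) = - (P *v x)" for x
    by (rule linear_neg[OF matrix_vector_mul_linear])
  ultimately have "(- z) $ j = of_real ((P *v real_vec (- a)) $ j) + \<i> * of_real ((P *v real_vec (- b)) $ j)" for j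
    unfolding real_vec_minus neg by simp
  then show ?thesis unfolding lattice_z_def by blast
qed

lemma zero_in_lattice: "0 \<in> lattice_w mu" "0 \<in> lattice_z P"
  unfolding lattice_w_def lattice_z_def
  by (intro CollectI exI[of _ 0]; simp add: matrix_vector_mult_def)+

definition join_coords :: "complex ^ ('n::finite \<times> bool) \<Rightarrow> complex ^ ('m::finite \<times> bool)
    \<Rightarrow> complex ^ (('n \<times> bool) + ('m \<times> bool))" where
  "join_coords w z = (\<chi> l. case l of Inl i \<Rightarrow> w $ i | Inr j \<Rightarrow> z $ j)"

lemma phi_axis: "phi lam (axis (a, b) c) = of_real lam * (if b then cnj c else c)"
proof -
  have "(\<Sum>i\<in>UNIV. axis (a, b) c $ (i, False) + cnj (axis (a, b) c $ (i, True)))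
      = (\<Sum>i\<in>UNIV. if i = a then (if b then cnj c else c) else 0)"
    by (rule sum.cong[OF refl]) (auto simp: axis_def)
  then show ?thesis by (simp add: phi_def)
qed

section \<open>The lattice\<close>

text \<open>
  The hypotheses on \<open>M\<close> and \<open>P\<close> make \<open>\<Gamma>\<close> a subgroup: \<open>M\<close> and, since its determinant is 1, its
  inverse preserve the integral vectors.
\<close>

locale solv_lattice =
  fixes lam :: real
    and M :: "int ^ ('m::finite \<times> bool) ^ ('m \<times> bool)"
    and P :: "real ^ ('m \<times> bool) ^ ('m \<times> bool)"
    and k :: "'n::finite \<times> bool \<Rightarrow> int"
    and mu :: "'n \<times> bool \<Rightarrow> real"
  assumes lam: "lam \<noteq> 0"
    and det_M: "det M = 1"
    and inv_P: "invertible P"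
    and conj_M: "P ** (\<chi> i j. real_of_int (M $ i $ j)) ** matrix_inv P =
           (\<chi> i j. if i = j then (if snd i then exp (- lam) else exp lam) else 0)"
    and k: "k i \<noteq> 0"
    and mu: "mu i = 2 * real_of_int (k i) * pi / lam"
begin

lemma mu_nonzero: "mu i \<noteq> 0"
  using lam k mu by simp

text \<open>
  On the lattice \<open>\<phi>\<close> takes values in \<open>\<lambda> \<int> + 2\<pi>\<i> \<int>\<close> because \<open>\<lambda> \<mu>\<^sub>i = 2\<pi>k\<^sub>i\<close>; hence \<open>\<rho>\<close> is real there.
\<close>

lemma exp_phi_lattice:
  assumes w: "w \<in> lattice_w mu"
  shows "\<exists>N::int. exp (phi lam w) = of_real (exp (lam * of_int N))"
proof -
  obtain a b where ab: "\<And>i. w $ i = of_int (a $ i) + \<i> * of_real (mu i) * of_int (b $ i)"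
    using w unfolding lattice_w_def by blast
  define N where "N = (\<Sum>i\<in>UNIV. a $ (i, False) + a $ (i, True))"
  define K where "K = (\<Sum>i\<in>UNIV. k (i, False) * b $ (i, False) - k (i, True) * b $ (i, True))"
  have lm: "of_real lam * complex_of_real (mu i) = 2 * of_int (k i) * of_real pi" for i
    using lam by (simp add: mu)
  have "of_real lam * (w $ (i, False) + cnj (w $ (i, True)))
      = of_real (lam * of_int (a $ (i, False) + a $ (i, True)))
        + 2 * of_int (k (i, False) * b $ (i, False) - k (i, True) * b $ (i, True)) * of_real pi * \<i>" for i
  proof -
    have "of_real lam * (w $ (i, False) + cnj (w $ (i, True)))
        = of_real (lam * of_int (a $ (i, False) + a $ (i, True)))
          + \<i> * (of_real lam * of_real (mu (i, False))) * of_int (b $ (i, False))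
          - \<i> * (of_real lam * of_real (mu (i, True))) * of_int (b $ (i, True))"
      by (simp add: ab algebra_simps)
    then show ?thesis unfolding lm by (simp add: algebra_simps)
  qed
  then have "phi lam w = of_real (lam * of_int N) + 2 * of_int K * of_real pi * \<i>"
    unfolding phi_def N_def K_def of_int_sum sum_distrib_left sum_distrib_right of_real_sum
    by (simp only: sum.distrib)
  moreover have "exp (2 * of_int K * of_real pi * \<i>) = 1"
    using exp_integer_2pi[of "of_int K"] by simp
  ultimately have "exp (phi lam w) = of_real (exp (lam * of_int N))"
    by (simp only: exp_add mult_1_right exp_of_real)
  then show ?thesis by blast
qed

lemma rho_factor_eq:
  assumes "exp (phi lam w) = of_real (exp c)"
  shows "rho_factor lam w b = of_real (exp (if b then - c else c))"
proof -
  have "exp (- cnj (phi lam w)) = inverse (cnj (exp (phi lam w)))"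
    by (simp add: exp_minus exp_cnj)
  then show ?thesis using assms by (simp add: rho_factor_def exp_minus)
qed

abbreviation MR :: "real ^ ('m \<times> bool) ^ ('m \<times> bool)" where
  "MR \<equiv> (\<chi> i j. real_of_int (M $ i $ j))"

lemma conj_M_vec: "(P *v (MR *v x)) $ j = exp (if snd j then - lam else lam) * (P *v x) $ j"
proof -
  let ?D = "(\<chi> i j. if i = j then (if snd i then exp (- lam) else exp lam) else 0)
    :: real ^ ('m \<times> bool) ^ ('m \<times> bool)"
  have "P ** MR ** matrix_inv P ** P = P ** MR"
    using inv_P by (simp add: matrix_inv_left matrix_mul_assoc[symmetric])
  then have "P ** MR = ?D ** P" using conj_M by simp
  then have "P *v (MR *v x) = ?D *v (P *v x)" by (simp add: matrix_vector_mul_assoc)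
  moreover have "(?D *v y) $ j = exp (if snd j then - lam else lam) * y $ j" for y
  proof -
    have "(?D *v y) $ j = (\<Sum>i\<in>UNIV. if i = j then exp (if snd j then - lam else lam) * y $ i else 0)"
      unfolding matrix_vector_mult_def vec_lambda_beta by (rule sum.cong[OF refl]) auto
    then show ?thesis by simp
  qed
  ultimately show ?thesis by simp
qed

lemma M_real_vec: "\<exists>b. MR *v real_vec a = real_vec b"
  by (intro exI[of _ "\<chi> i. \<Sum>j\<in>UNIV. M $ i $ j * a $ j"]) (simp add: vec_eq_iff matrix_vector_mult_def)

text \<open>
  Cramer's rule expresses the solution by determinants of integral matrices divided by \<open>det M = 1\<close>.
\<close>

lemma M_real_vec_inverse: "\<exists>b. MR *v real_vec b = real_vec a"
proof -
  have det: "det MR = 1" using det_M of_int_det[of M] by simp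
  define b where "b = (\<chi> l. det (\<chi> i j. if j = l then a $ i else M $ i $ j))"
  have "real_vec b = (\<chi> l. det (\<chi> i j. if j = l then real_vec a $ i else MR $ i $ j) / det MR)"
    by (simp add: vec_eq_iff b_def of_int_det det if_distrib cong: if_cong)
  moreover have "det MR \<noteq> 0" unfolding det by simp
  ultimately have "MR *v real_vec b = real_vec a" by (rule iffD2[OF cramer, rotated])
  then show ?thesis by blast
qed

text \<open>
  The action of \<open>\<rho>(w)\<close> on the fibre when \<open>exp (\<phi>(w)) = exp c\<close>.
\<close>

definition fibre_scale :: "real \<Rightarrow> complex ^ ('m \<times> bool) \<Rightarrow> complex ^ ('m \<times> bool)" where
  "fibre_scale c z = (\<chi> j. of_real (exp (if snd j then - c else c)) * z $ j)"

lemma fibre_scale_add: "fibre_scale (c + d) z = fibre_scale c (fibre_scale d z)"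
  by (auto simp: fibre_scale_def vec_eq_iff exp_add[symmetric] simp flip: of_real_mult)

lemma fibre_scale_lam_lattice:
  assumes "z \<in> lattice_z P"
  shows "fibre_scale lam z \<in> lattice_z P" "fibre_scale (- lam) z \<in> lattice_z P"
proof -
  obtain a b where ab:
    "\<And>j. z $ j = of_real ((P *v real_vec a) $ j) + \<i> * of_real ((P *v real_vec b) $ j)"
    using assms unfolding lattice_z_def by blast
  obtain a1 b1 where f: "MR *v real_vec a = real_vec a1" "MR *v real_vec b = real_vec b1"
    using M_real_vec by blast
  obtain a2 b2 where g: "MR *v real_vec a2 = real_vec a" "MR *v real_vec b2 = real_vec b"
    using M_real_vec_inverse by blast
  have "fibre_scale lam z $ j = of_real ((P *v real_vec a1) $ j) + \<i> * of_real ((P *v real_vec b1) $ j)" for j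
    unfolding f[symmetric] conj_M_vec by (simp add: fibre_scale_def ab algebra_simps)
  then show "fibre_scale lam z \<in> lattice_z P" unfolding lattice_z_def by blast
  have "fibre_scale (- lam) z $ j = of_real ((P *v real_vec a2) $ j) + \<i> * of_real ((P *v real_vec b2) $ j)" for j
    using conj_M_vec[of "real_vec a2" j] conj_M_vec[of "real_vec b2" j]
    unfolding g by (auto simp: fibre_scale_def ab exp_minus field_simps)
  then show "fibre_scale (- lam) z \<in> lattice_z P" unfolding lattice_z_def by blast
qed

lemma fibre_scale_int_lattice:
  assumes "z \<in> lattice_z P"
  shows "fibre_scale (lam * of_int N) z \<in> lattice_z P"
proof (induction N rule: int_induct[where k = 0])
  case base
  have "fibre_scale 0 z = z" by (simp add: fibre_scale_def vec_eq_iff)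
  then show ?case using assms by simp
next
  case (step1 i)
  then show ?case using fibre_scale_lam_lattice(1) fibre_scale_add[of lam "lam * of_int i" z] by (simp add: algebra_simps)
next
  case (step2 i)
  then show ?case using fibre_scale_lam_lattice(2) fibre_scale_add[of "- lam" "lam * of_int i" z] by (simp add: algebra_simps)
qed

lemma rho_lattice:
  assumes "w \<in> lattice_w mu" "z \<in> lattice_z P"
  shows "rho lam w *v z \<in> lattice_z P"
proof -
  obtain N :: int where "exp (phi lam w) = of_real (exp (lam * of_int N))"
    using exp_phi_lattice[OF assms(1)] by blast
  then have "rho lam w *v z = fibre_scale (lam * of_int N) z"
    by (simp add: vec_eq_iff rho_mult rho_factor_eq fibre_scale_def)
  then show ?thesis using fibre_scale_int_lattice[OF assms(2)] by simp
qed

lemma subgroup_Gam: "subgroup (Gam mu P) (solv_group lam)"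
proof -
  interpret group "solv_group lam :: ('n, 'm) solv monoid" by (rule group_solv_group)
  show ?thesis
  proof (rule subgroupI)
    show "Gam mu P \<subseteq> carrier (solv_group lam)" by (simp add: solv_group_def)
    show "Gam mu P \<noteq> {}" using zero_in_lattice by (auto simp: Gam_def)
    fix x assume x: "x \<in> Gam mu P"
    have "inv\<^bsub>solv_group lam\<^esub> x = (- fst x, - (rho lam (- fst x) *v snd x))"
      by (rule inv_equality) (simp_all add: solv_group_def split_beta)
    then show "inv\<^bsub>solv_group lam\<^esub> x \<in> Gam mu P"
      using x by (auto simp: Gam_def intro!: lattice_w_minus lattice_z_minus rho_lattice)
    fix y assume "y \<in> Gam mu P"
    then show "x \<otimes>\<^bsub>solv_group lam\<^esub> y \<in> Gam mu P"
      using x by (auto simp: Gam_def solv_group_def intro!: lattice_w_add lattice_z_add rho_lattice)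
  qed
qed

section \<open>Lifting a metric to the universal covering\<close>

definition proj :: "complex ^ (('n \<times> bool) + ('m \<times> bool)) \<Rightarrow> ('n, 'm) solv set" where
  "proj x = Gam mu P #>\<^bsub>solv_group lam\<^esub> to_solv x"

lemma proj_deck:
  assumes "(w, z) \<in> Gam mu P"
  shows "proj (deck lam w z x) = proj x"
proof -
  interpret group "solv_group lam :: ('n, 'm) solv monoid" by (rule group_solv_group)
  have "to_solv (deck lam w z x) \<in> Gam mu P #>\<^bsub>solv_group lam\<^esub> to_solv x"
    unfolding to_solv_deck r_coset_def using assms by blast
  from repr_independence[OF this _ subgroup_Gam] show ?thesis
    by (simp add: proj_def solv_group_def)
qed

lemma proj_eq_iff: "proj x = proj y \<longleftrightarrow> (\<exists>w z. (w, z) \<in> Gam mu P \<and> x = deck lam w z y)"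
proof
  assume eq: "proj x = proj y"
  interpret group "solv_group lam :: ('n, 'm) solv monoid" by (rule group_solv_group)
  have "to_solv x \<in> proj x"
    unfolding proj_def by (rule rcos_self) (simp_all add: solv_group_def[of lam] subgroup_Gam[unfolded solv_group_def])
  then have "to_solv x \<in> proj y" using eq by (simp only:)
  then obtain w z where "(w, z) \<in> Gam mu P" "to_solv x = (w, z) \<otimes>\<^bsub>solv_group lam\<^esub> to_solv y"
    unfolding proj_def r_coset_def by auto
  then show "\<exists>w z. (w, z) \<in> Gam mu P \<and> x = deck lam w z y"
    unfolding to_solv_deck[symmetric] using injD[OF inj_to_solv] by blast
next
  assume "\<exists>w z. (w, z) \<in> Gam mu P \<and> x = deck lam w z y"
  then show "proj x = proj y" using proj_deck by auto
qed

text \<open>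
  A lattice element that moves a point by less than \<open>2 r\<close> has small coordinates: the integers that
  describe its base part, and after applying \<open>P\<^sup>-\<^sup>1\<close> those that describe its fibre part, are smaller than 1
  in absolute value. The bound does not depend on the point, because a lattice element with trivial
  base part is a pure translation.
\<close>

lemma proj_locally_injective: "\<exists>r>0. \<forall>x0. inj_on proj (ball x0 r)"
proof -
  define L where "L = (\<Sum>i\<in>UNIV. \<Sum>j\<in>UNIV. \<bar>matrix_inv P $ i $ j\<bar>) + (\<Sum>i\<in>UNIV. 1 / \<bar>mu i\<bar>)"
  define r where "r = 1 / (2 * (1 + L))"
  have L: "L \<ge> 0" unfolding L_def by (intro add_nonneg_nonneg sum_nonneg) auto
  have r: "r > 0" "2 * r \<le> 1" "2 * r * L < 1" using L by (auto simp: r_def field_simps)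
  have "x = y" if x: "x \<in> ball x0 r" and y: "y \<in> ball x0 r" and eq: "proj x = proj y" for x y x0
  proof -
    obtain w z where wz: "w \<in> lattice_w mu" "z \<in> lattice_z P" and xy: "x = deck lam w z y"
      using eq unfolding proj_eq_iff Gam_def by auto
    have "dist x y < 2 * r" using x y dist_triangle2[of x y x0] by (simp add: dist_commute)
    then have comp: "norm (x $ l - y $ l) < 2 * r" for l
      using Finite_Cartesian_Product.norm_nth_le[of "x - y" l] by (simp add: dist_norm)
    obtain a b where ab: "\<And>i. w $ i = of_int (a $ i) + \<i> * of_real (mu i) * of_int (b $ i)"
      using wz(1) unfolding lattice_w_def by blast
    have "w = 0"
    proof -
      have "w $ i = 0" for i
      proof -
        have "norm (w $ i) < 2 * r"
          using comp[of "Inl i"] by (simp add: xy deck_def deck_lin_def)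
        moreover have "Re (w $ i) = of_int (a $ i)" "Im (w $ i) = mu i * of_int (b $ i)"
          by (simp_all add: ab)
        ultimately have re: "\<bar>real_of_int (a $ i)\<bar> < 2 * r" and im: "\<bar>mu i * of_int (b $ i)\<bar> < 2 * r"
          using abs_Re_le_cmod[of "w $ i"] abs_Im_le_cmod[of "w $ i"] by auto
        have "a $ i = 0" using re r by linarith
        moreover have "b $ i = 0"
        proof -
          have "1 / \<bar>mu i\<bar> \<le> (\<Sum>i\<in>UNIV. 1 / \<bar>mu i\<bar>)" by (rule member_le_sum) auto
          also have "\<dots> \<le> L" unfolding L_def by (simp add: sum_nonneg)
          finally have "2 * r * (1 / \<bar>mu i\<bar>) < 1" using r mult_left_mono[of "1 / \<bar>mu i\<bar>" L "2 * r"] by linarith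
          then have "2 * r < \<bar>mu i\<bar>" using mu_nonzero[of i] by (simp add: field_simps)
          then have "\<bar>mu i\<bar> * \<bar>real_of_int (b $ i)\<bar> < \<bar>mu i\<bar> * 1" using im by (simp add: abs_mult)
          then have "\<bar>real_of_int (b $ i)\<bar> < 1" using mu_nonzero[of i] mult_less_cancel_left_pos[of "\<bar>mu i\<bar>"] by simp
          then show ?thesis by linarith
        qed
        ultimately show ?thesis by (simp add: ab)
      qed
      then show ?thesis by (simp add: vec_eq_iff)
    qed
    have zc: "norm (z $ j) < 2 * r" for j
      using comp[of "Inr j"] \<open>w = 0\<close> by (simp add: xy deck_def deck_lin_def)
    obtain c d where cd:
      "\<And>j. z $ j = of_real ((P *v real_vec c) $ j) + \<i> * of_real ((P *v real_vec d) $ j)"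
      using wz(2) unfolding lattice_z_def by blast
    have small: "h = 0" if "\<And>j. \<bar>(P *v real_vec h) $ j\<bar> < 2 * r" for h
    proof -
      have h: "matrix_inv P *v (P *v real_vec h) = real_vec h"
        using inv_P by (simp add: matrix_vector_mul_assoc matrix_inv_left)
      have "h $ i = 0" for i
      proof -
        have "real_of_int (h $ i) = (\<Sum>j\<in>UNIV. matrix_inv P $ i $ j * (P *v real_vec h) $ j)"
          using arg_cong[OF h, of "\<lambda>v. v $ i"] by (simp add: matrix_vector_mult_def[of "matrix_inv P"])
        also have "\<bar>\<dots>\<bar> \<le> (\<Sum>j\<in>UNIV. \<bar>matrix_inv P $ i $ j\<bar> * (2 * r))"
          by (intro order_trans[OF sum_abs] sum_mono)
             (simp only: abs_mult mult_left_mono[OF less_imp_le[OF that] abs_ge_zero])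
        also have "\<dots> = 2 * r * (\<Sum>j\<in>UNIV. \<bar>matrix_inv P $ i $ j\<bar>)"
          by (simp add: sum_distrib_left mult_ac)
        also have "\<dots> \<le> 2 * r * L"
        proof -
          have "(\<Sum>j\<in>UNIV. \<bar>matrix_inv P $ i $ j\<bar>) \<le> (\<Sum>i\<in>UNIV. \<Sum>j\<in>UNIV. \<bar>matrix_inv P $ i $ j\<bar>)"
            by (rule member_le_sum) (auto intro!: sum_nonneg)
          also have "\<dots> \<le> L" unfolding L_def by (simp add: sum_nonneg)
          finally show ?thesis using r by (intro mult_left_mono) auto
        qed
        finally show ?thesis using r by linarith
      qed
      then show ?thesis by (simp add: vec_eq_iff)
    qed
    have "Re (z $ j) = (P *v real_vec c) $ j" "Im (z $ j) = (P *v real_vec d) $ j" for j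
      by (simp_all add: cd)
    then have "c = 0" "d = 0"
      using zc abs_Re_le_cmod abs_Im_le_cmod
      by (auto intro!: small simp: order.strict_trans1) (metis order.strict_trans1)+
    then have "z $ j = 0" for j
      unfolding cd by (simp add: matrix_vector_mult_def)
    then have "z = 0" by (simp add: vec_eq_iff)
    then show ?thesis using xy \<open>w = 0\<close> by simp
  qed
  then show ?thesis using r by (auto simp: inj_on_def)
qed

text \<open>
  Charts are the local inverses of the covering map on balls of a fixed radius. The transition
  between two such charts is locally a deck transformation, so compatibility of the metric with
  coordinate changes says both that the local expressions glue to a field \<open>G\<close> on the whole covering
  and that \<open>G\<close> is invariant under the lattice.
\<close>

lemma lift_astheno_kaehler:
  fixes g :: "(('n, 'm) solv set, ('n \<times> bool) + ('m \<times> bool)) metric"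
  assumes ak: "astheno_kaehler (solv_atlas lam mu P) g"
  obtains G where "\<And>x. hermitian_product (G x)"
    and "\<And>u v. smooth_on UNIV (\<lambda>x. G x u v)"
    and "\<And>w z x u v. (w, z) \<in> Gam mu P \<Longrightarrow>
      G (deck lam w z x) (deck_lin lam w u) (deck_lin lam w v) = G x u v"
    and "\<And>p x v. p = CARD(('n \<times> bool) + ('m \<times> bool)) - 2 \<Longrightarrow>
      del (2 * p + 1) (delbar (2 * p)
        (\<lambda>y. wedge_power (\<lambda>v. complex_of_real (G y (\<i> *s v 0) (v 1))) p)) x v = 0"
proof -
  obtain r where r: "r > 0" and inj: "\<And>x0. inj_on proj (ball x0 r)"
    using proj_locally_injective by blast
  define U where "U x0 = proj ` ball x0 r" for x0
  define c where "c x0 = inv_into (ball x0 r) proj" for x0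
  have c_proj: "c x0 (proj y) = y" if "y \<in> ball x0 r" for x0 y
    unfolding c_def using that inj by (rule inv_into_f_f[rotated])
  have c_U: "c x0 ` U x0 = ball x0 r" for x0
    unfolding U_def image_image using c_proj by (simp add: image_cong[OF refl c_proj])
  have bl: "bounded_linear (to_solv :: complex ^ (('n \<times> bool) + ('m \<times> bool)) \<Rightarrow> ('n, 'm) solv)"
    using linear_to_solv linear_conv_bounded_linear by blast
  have atlas: "(U x0, c x0) \<in> solv_atlas lam mu P" for x0
  proof -
    have "U x0 \<subseteq> solvmanifold lam mu P"
      by (auto simp: U_def proj_def solvmanifold_def RCOSETS_def solv_group_def)
    moreover have "proj (c x0 q) = q" if "q \<in> U x0" for q
      unfolding c_def using that by (simp add: U_def f_inv_into_f)
    moreover have "frechet_derivative to_solv (at x) = (to_solv :: _ \<Rightarrow> ('n, 'm) solv)" for x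
      using frechet_derivative_at[OF bounded_linear_imp_has_derivative[OF bl]] by simp
    moreover have "coframe lam (to_solv x) (to_solv (\<i> *s v)) = \<i> *s coframe lam (to_solv x) (to_solv v)"
      for x v :: "complex ^ (('n \<times> bool) + ('m \<times> bool))"
      by (auto simp: coframe_def to_solv_def vec_eq_iff split: sum.split)
    ultimately show ?thesis
      unfolding solv_atlas_def
      by (auto simp: c_U proj_def[symmetric] Let_def inj_to_solv
          intro!: exI[of _ to_solv] smooth_on_bounded_linear bl)
  qed
  have hm: "hermitian_metric (solv_atlas lam mu P) g"
    using ak by (simp add: astheno_kaehler_def)
  note hm' = hm[unfolded hermitian_metric_def]
  have herm: "hermitian_product (g (U x0, c x0) x)" if x: "x \<in> ball x0 r" for x0 x
  proof -
    have "x \<in> c x0 ` U x0" using x by (simp only: c_U)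
    from bspec[OF bspec[OF conjunct1[OF hm'] atlas[of x0], unfolded prod.case] this]
    show ?thesis by unfold_locales simp_all
  qed
  have smooth: "smooth_on (ball x0 r) (\<lambda>x. g (U x0, c x0) x u v)" for x0 u v
    using bspec[OF conjunct1[OF conjunct2[OF hm']] atlas[of x0], unfolded prod.case]
    unfolding c_U by blast
  have change: "g (U x0, c x0) y u v = g (U x1, c x1) (deck lam w z y) (deck_lin lam w u) (deck_lin lam w v)"
    if wz: "(w, z) \<in> Gam mu P" and y0: "y \<in> ball x0 r" and y1: "deck lam w z y \<in> ball x1 r"
    for x0 x1 y w z u v
  proof -
    let ?\<tau> = "transition (U x0, c x0) (U x1, c x1)"
    have inj_c: "inj_on (c x0) (U x0)"
      unfolding c_def U_def by (rule inj_on_inv_into) simp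
    have \<tau>: "?\<tau> y' = deck lam w z y'" if "y' \<in> ball x0 r" "deck lam w z y' \<in> ball x1 r" for y'
    proof -
      have "inv_into (U x0) (c x0) y' = proj y'"
        by (rule inv_into_f_eq[OF inj_c]) (use that c_proj in \<open>auto simp: U_def\<close>)
      then have "?\<tau> y' = c x1 (proj (deck lam w z y'))"
        by (simp add: transition_def proj_deck[OF wz])
      then show ?thesis using that c_proj by simp
    qed
    define S where "S = ball x0 r \<inter> deck lam w z -` ball x1 r"
    have "continuous_on UNIV (deck lam w z :: _ \<Rightarrow> complex ^ (('n \<times> bool) + ('m \<times> bool)))"
      by (rule has_derivative_continuous_on[OF has_derivative_at_withinI[OF deck_has_derivative]])
    then have "open S" unfolding S_def by (intro open_Int open_vimage) auto
    moreover have "y \<in> S" using y0 y1 by (simp add: S_def)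
    moreover have "deck lam w z y' = ?\<tau> y'" if "y' \<in> S" for y'
      using that by (intro \<tau>[symmetric]) (simp_all only: S_def Int_iff vimage_eq)
    ultimately have "(?\<tau> has_derivative deck_lin lam w) (at y)"
      by (rule has_derivative_transform_within_open[OF deck_has_derivative])
    then have D: "frechet_derivative ?\<tau> (at y) = deck_lin lam w"
      by (rule frechet_derivative_at[symmetric])
    have "proj y \<in> U x0 \<inter> U x1"
      unfolding U_def using imageI[OF y0, of proj] imageI[OF y1, of proj] by (simp only: proj_deck[OF wz] Int_iff)
    then have "c x0 (proj y) \<in> c x0 ` (U x0 \<inter> U x1)" by (rule imageI)
    then have "y \<in> c x0 ` (U x0 \<inter> U x1)" by (simp only: c_proj[OF y0])
    from bspec[OF bspec[OF bspec[OF conjunct2[OF conjunct2[OF hm']] atlas[of x0], unfolded prod.case]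
          atlas[of x1], unfolded prod.case] this]
    show ?thesis unfolding D Let_def \<tau>[OF y0 y1] by blast
  qed
  define G where "G x = g (U x, c x) x" for x
  have zero: "(0, 0) \<in> Gam mu P" by (simp add: Gam_def zero_in_lattice)
  have G_eq: "g (U x0, c x0) y = G y" if "y \<in> ball x0 r" for x0 y
    using change[OF zero that, of y] r by (auto simp: G_def fun_eq_iff)
  show ?thesis
  proof (rule that)
    show "hermitian_product (G x)" for x using herm[of x x] r by (simp add: G_def)
    show "smooth_on UNIV (\<lambda>x. G x u v)" for u v
      unfolding smooth_on_def
    proof (intro allI Ck_on_local)
      fix k and x :: "complex ^ (('n \<times> bool) + ('m \<times> bool))"
      have "Ck_on k (ball x r) (\<lambda>y. G y u v)"
        by (rule Ck_on_cong[OF open_ball _ smooth_Ck[OF smooth[of x u v]]]) (simp add: G_eq)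
      then show "\<exists>T. open T \<and> x \<in> T \<and> Ck_on k T (\<lambda>x. G x u v)"
        using r by (intro exI[of _ "ball x r"]) simp
    qed
    show "G (deck lam w z x) (deck_lin lam w u) (deck_lin lam w v) = G x u v"
      if "(w, z) \<in> Gam mu P" for w z x u v
      using change[OF that, of x x "deck lam w z x" u v] r by (simp add: G_def)
    show "del (2 * p + 1) (delbar (2 * p)
        (\<lambda>y. wedge_power (\<lambda>v. complex_of_real (G y (\<i> *s v 0) (v 1))) p)) x v = 0"
      if p: "p = CARD(('n \<times> bool) + ('m \<times> bool)) - 2" for p x v
    proof -
      have form: "fundamental_form g (U x, c x) y = (\<lambda>v. complex_of_real (G y (\<i> *s v 0) (v 1)))"
        if "y \<in> ball x r" for y
        using G_eq[OF that] by (simp add: fundamental_form_def fun_eq_iff)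
      have "del (2 * p + 1) (delbar (2 * p)
          (\<lambda>y. wedge_power (fundamental_form g (U x, c x) y) p)) x v = 0"
      proof -
        have "x \<in> c x ` U x" using r by (simp add: c_U)
        from bspec[OF bspec[OF conjunct2[OF ak[unfolded astheno_kaehler_def]] atlas[of x],
              unfolded prod.case] this]
        show ?thesis unfolding p Let_def by blast
      qed
      moreover have "del (2 * p + 1) (delbar (2 * p)
          (\<lambda>y. wedge_power (fundamental_form g (U x, c x) y) p)) x v
        = del (2 * p + 1) (delbar (2 * p)
          (\<lambda>y. wedge_power (\<lambda>v. complex_of_real (G y (\<i> *s v 0) (v 1))) p)) x v"
        by (intro del_cong_open[of "ball x r"]) (use r in \<open>auto simp: form\<close>)
      ultimately show ?thesis by simp
    qed
  qed
qed

section \<open>Translations in the lattice\<close>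

text \<open>
  The lattice elements with \<open>\<rho> = 1\<close>; by \<open>deck_period\<close> these act as translations.
\<close>

definition periods :: "(complex ^ (('n \<times> bool) + ('m \<times> bool))) set" where
  "periods = {join_coords w z | w z. w \<in> lattice_w mu \<and> z \<in> lattice_z P \<and> exp (phi lam w) = 1}"

lemma deck_lin_period: "exp (phi lam w) = 1 \<Longrightarrow> deck_lin lam w u = u"
  using rho_factor_eq[of w 0]
  by (auto simp: deck_lin_def vec_eq_iff split: sum.split)

lemma deck_period: "exp (phi lam w) = 1 \<Longrightarrow> deck lam w z x = x + join_coords w z"
  by (simp add: deck_def deck_lin_period join_coords_def add.commute)

lemma real_axis_lattice_w: "axis i (of_int n) \<in> lattice_w mu"
  unfolding lattice_w_def
  by (intro CollectI exI[of _ "axis i n"] exI[of _ 0]) (simp add: axis_def)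

lemma imag_axis_in_span: "axis (Inl i) \<i> \<in> span periods"
proof -
  obtain a b where i: "i = (a, b)" by (cases i)
  let ?w = "axis i (\<i> * of_real (mu i))"
  have "?w \<in> lattice_w mu"
    unfolding lattice_w_def
    by (intro CollectI exI[of _ 0] exI[of _ "axis i 1"]) (simp add: axis_def)
  moreover have "exp (phi lam ?w) = 1"
  proof -
    have "of_real lam * complex_of_real (mu i) = 2 * of_int (k i) * of_real pi"
      using lam by (simp add: mu)
    then have "phi lam ?w = 2 * of_int (if b then - k i else k i) * of_real pi * \<i>"
      unfolding i phi_axis by (auto simp: algebra_simps)
    then show ?thesis using exp_integer_2pi[of "of_int (if b then - k i else k i)"] by simp
  qed
  ultimately have "join_coords ?w 0 \<in> periods"
    unfolding periods_def using zero_in_lattice(2) by blast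
  then have "(1 / mu i) *\<^sub>R join_coords ?w 0 \<in> span periods"
    by (intro span_scale span_base)
  also have "(1 / mu i) *\<^sub>R join_coords ?w 0 = axis (Inl i) \<i>"
    using mu_nonzero[of i]
    by (auto simp: join_coords_def axis_def vec_eq_iff complex_eq_iff split: sum.split)
  finally show ?thesis .
qed

lemma real_axis_diff_in_span: "axis (Inl i) 1 - axis (Inl (a, False)) 1 \<in> span periods"
proof -
  obtain a' b where i: "i = (a', b)" by (cases i)
  let ?w = "axis i 1 + (- axis (a, False) 1)"
  have "?w \<in> lattice_w mu"
    using real_axis_lattice_w[of _ 1] by (intro lattice_w_add lattice_w_minus) simp_all
  moreover have "phi lam ?w = 0"
  proof -
    have "phi lam (- axis (a, False) 1 + axis (a, False) 1) = 0" by simp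
    then have "phi lam (- axis (a, False) 1) = - phi lam (axis (a, False) 1)"
      unfolding phi_add by (simp add: eq_neg_iff_add_eq_0)
    then show ?thesis unfolding phi_add i by (simp add: phi_axis)
  qed
  ultimately have "join_coords ?w 0 \<in> periods"
    unfolding periods_def using zero_in_lattice(2) by fastforce
  also have "join_coords ?w 0 = axis (Inl i) 1 - axis (Inl (a, False)) 1"
    by (auto simp: join_coords_def axis_def vec_eq_iff split: sum.split)
  finally show ?thesis by (rule span_base)
qed

lemma fibre_in_span: "join_coords 0 z \<in> span periods"
proof -
  define s :: "complex \<Rightarrow> 'm \<times> bool \<Rightarrow> complex ^ ('m \<times> bool)"
    where "s c i = (\<chi> j. c * of_real (P $ j $ i))" for c i
  have base: "join_coords 0 (s 1 i) \<in> span periods" "join_coords 0 (s \<i> i) \<in> span periods" for i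
  proof -
    have P: "(P *v real_vec (axis i 1)) $ j = P $ j $ i" for j
    proof -
      have "(P *v real_vec (axis i 1)) $ j = (\<Sum>l\<in>UNIV. if l = i then P $ j $ l else 0)"
        unfolding matrix_vector_mult_def vec_lambda_beta by (rule sum.cong[OF refl]) (simp add: axis_def)
      then show ?thesis by simp
    qed
    have P0: "(P *v real_vec 0) $ j = 0" for j by (simp add: matrix_vector_mult_def)
    have "s 1 i $ j = of_real ((P *v real_vec (axis i 1)) $ j) + \<i> * of_real ((P *v real_vec 0) $ j)" for j
      unfolding P P0 by (simp add: s_def)
    then have "s 1 i \<in> lattice_z P" unfolding lattice_z_def by blast
    moreover have "s \<i> i $ j = of_real ((P *v real_vec 0) $ j) + \<i> * of_real ((P *v real_vec (axis i 1)) $ j)" for j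
      unfolding P P0 by (simp add: s_def)
    then have "s \<i> i \<in> lattice_z P" unfolding lattice_z_def by blast
    moreover have "join_coords 0 z' \<in> span periods" if "z' \<in> lattice_z P" for z'
    proof -
      have "0 \<in> lattice_w mu" "exp (phi lam (0 :: complex ^ ('n \<times> bool))) = 1"
        by (simp_all add: zero_in_lattice)
      with that show ?thesis unfolding periods_def by (intro span_base) blast
    qed
    ultimately show "join_coords 0 (s 1 i) \<in> span periods" "join_coords 0 (s \<i> i) \<in> span periods"
      by blast+
  qed
  define a where "a = matrix_inv P *v (\<chi> j. Re (z $ j))"
  define b where "b = matrix_inv P *v (\<chi> j. Im (z $ j))"
  have PP: "P ** matrix_inv P = mat 1"
    using matrix_inv_left[OF inv_P] by (simp only: matrix_left_right_inverse)
  have "(\<Sum>i\<in>UNIV. P $ j $ i * a $ i) = Re (z $ j)" "(\<Sum>i\<in>UNIV. P $ j $ i * b $ i) = Im (z $ j)" for j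
  proof -
    have "P *v a = (\<chi> j. Re (z $ j))" "P *v b = (\<chi> j. Im (z $ j))"
      unfolding a_def b_def matrix_vector_mul_assoc PP by simp_all
    then show "(\<Sum>i\<in>UNIV. P $ j $ i * a $ i) = Re (z $ j)" "(\<Sum>i\<in>UNIV. P $ j $ i * b $ i) = Im (z $ j)"
      using matrix_vector_mul_component[of P a j] matrix_vector_mul_component[of P b j]
      by (simp_all add: inner_vec_def)
  qed
  then have "join_coords 0 z = (\<Sum>i\<in>UNIV. a $ i *\<^sub>R join_coords 0 (s 1 i) + b $ i *\<^sub>R join_coords 0 (s \<i> i))"
    by (auto simp: join_coords_def vec_eq_iff s_def complex_eq_iff mult.commute split: sum.split)
  also have "\<dots> \<in> span periods"
    by (intro span_sum span_add span_scale base)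
  finally show ?thesis .
qed

text \<open>
  The fibre directions lie in the span because the columns of \<open>P\<close> and their multiples by \<open>\<i>\<close> form a
  real basis of the fibre.
\<close>

lemma vanishing_base_in_span:
  assumes "\<And>i. x $ Inl i = 0"
  shows "x \<in> span periods"
proof -
  have "x = join_coords 0 (\<chi> j. x $ Inr j)"
    using assms by (auto simp: join_coords_def vec_eq_iff split: sum.split)
  then show ?thesis using fibre_in_span by metis
qed

section \<open>Nonexistence of astheno-Kaehler metrics\<close>

text \<open>
  Each pair of fibre coordinates contributes the factors \<open>e\<^bsup>c\<^esup>\<close> and \<open>e\<^bsup>-c\<^esup>\<close>.
\<close>

lemma prod_fibre_weights:
  "(\<Prod>l\<in>(UNIV :: (('n \<times> bool) + ('m \<times> bool)) set).
     case l of Inl i \<Rightarrow> 1 | Inr j \<Rightarrow> exp (if snd j then - c else c :: real)) = 1"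
proof -
  have "(\<Sum>j\<in>(UNIV :: ('m \<times> bool) set). if snd j then - c else c)
      = (\<Sum>a\<in>(UNIV :: 'm set). \<Sum>b\<in>UNIV. if b then - c else c)"
    unfolding sum.cartesian_product by (simp add: split_beta)
  then have "(\<Sum>j\<in>(UNIV :: ('m \<times> bool) set). if snd j then - c else c) = 0"
    by (simp add: UNIV_bool)
  then have "(\<Prod>j\<in>(UNIV :: ('m \<times> bool) set). exp (if snd j then - c else c)) = 1"
    unfolding exp_sum[OF finite, symmetric] by simp
  then show ?thesis
    unfolding UNIV_Plus_UNIV[symmetric] by (subst prod.Plus) simp_all
qed

lemma not_astheno_kaehler:
  fixes g :: "(('n, 'm) solv set, ('n \<times> bool) + ('m \<times> bool)) metric"
  shows "\<not> astheno_kaehler (solv_atlas lam mu P) g"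
proof
  assume "astheno_kaehler (solv_atlas lam mu P) g"
  then obtain G where herm: "\<And>x. hermitian_product (G x)"
    and G_smooth: "\<And>u v. smooth_on UNIV (\<lambda>x. G x u v)"
    and G_inv: "\<And>w z x u v. (w, z) \<in> Gam mu P \<Longrightarrow>
      G (deck lam w z x) (deck_lin lam w u) (deck_lin lam w v) = G x u v"
    and G_closed: "\<And>p x v. p = CARD(('n \<times> bool) + ('m \<times> bool)) - 2 \<Longrightarrow>
      del (2 * p + 1) (delbar (2 * p)
        (\<lambda>y. wedge_power (\<lambda>v. complex_of_real (G y (\<i> *s v 0) (v 1))) p)) x v = 0"
    by (rule lift_astheno_kaehler) blast
  define p where "p = CARD(('n \<times> bool) + ('m \<times> bool)) - 2"
  define W where "W y = wedge_power (\<lambda>v. complex_of_real (G y (\<i> *s v 0) (v 1))) p" for y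
  have W_eq: "W y v = pfaff p (\<lambda>i j. complex_of_real (G y (\<i> *s v i) (v j))) / 2 ^ p" for y v
    unfolding W_def using wedge_power_eq_pfaff[of "\<lambda>a b. complex_of_real (G y (\<i> *s a) b)" p v] .
  have W_closed: "del (2 * p + 1) (delbar (2 * p) W) x v = 0" for x v
    unfolding W_def[abs_def] by (rule G_closed) (rule p_def)
  have W_smooth: "smooth_on UNIV (\<lambda>x. W x v)" for v
    unfolding W_eq
    by (intro smooth_on_bounded_linear_comp[OF _ bounded_linear_divide] smooth_pfaff
        smooth_on_bounded_linear_comp[OF _ bounded_linear_of_real] G_smooth) auto
  have W_periodic: "W (x + u) v = W x v" if "u \<in> periods" for x u v
  proof -
    obtain w z where "w \<in> lattice_w mu" "z \<in> lattice_z P" and e1: "exp (phi lam w) = 1"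
      and u: "u = join_coords w z" using \<open>u \<in> periods\<close> unfolding periods_def by blast
    then have "G (x + u) a b = G x a b" for a b
      using G_inv[of w z x a b] by (simp add: Gam_def deck_period[OF e1] deck_lin_period[OF e1])
    then show ?thesis by (simp add: W_eq)
  qed

  \<comment> \<open>The frame omits \<open>j0\<close>, an odd fibre position, whose weight under translation by \<open>N e\<close> is \<open>e\<^bsup>\<lambda>N\<^esup>\<close>.\<close>
  define i0 :: "'n \<times> bool" where "i0 = (undefined, False)"
  define j0 :: "'m \<times> bool" where "j0 = (undefined, False)"
  define e :: "complex ^ (('n \<times> bool) + ('m \<times> bool))" where "e = axis (Inl i0) 1"
  define K where "K = UNIV - {Inl i0, Inr j0 :: ('n \<times> bool) + ('m \<times> bool)}"
  have "card K = p" unfolding K_def p_def by (subst card_Diff_subset) auto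
  then obtain \<kappa> where \<kappa>: "bij_betw \<kappa> {..<p} K"
    using ex_bij_betw_nat_finite[of K] by (auto simp: lessThan_atLeast0)
  define u :: "nat \<Rightarrow> complex ^ (('n \<times> bool) + ('m \<times> bool))" where
    "u l = (case \<kappa> l of Inl i \<Rightarrow> axis (Inl i) 1 - axis (Inl i0) 1 | Inr j \<Rightarrow> axis (Inr j) 1)" for l
  have \<i>e: "\<i> *s e \<in> span periods"
  proof -
    have "\<i> *s e = axis (Inl i0) \<i>" by (simp add: e_def axis_def vec_eq_iff)
    then show ?thesis using imag_axis_in_span by simp
  qed
  have u_span: "u l \<in> span periods" "\<i> *s u l \<in> span periods" for l
  proof -
    show "u l \<in> span periods"
    proof (cases "\<kappa> l")
      case (Inl i)
      then show ?thesis using real_axis_diff_in_span[of i undefined] by (simp add: u_def i0_def)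
    next
      case (Inr j)
      then show ?thesis by (intro vanishing_base_in_span) (simp add: u_def axis_def)
    qed
    show "\<i> *s u l \<in> span periods"
    proof (cases "\<kappa> l")
      case (Inl i)
      then have "\<i> *s u l = axis (Inl i) \<i> - axis (Inl i0) \<i>"
        by (simp add: u_def axis_def vec_eq_iff)
      then show ?thesis using span_diff[OF imag_axis_in_span imag_axis_in_span] by metis
    next
      case (Inr j)
      then show ?thesis by (intro vanishing_base_in_span) (simp add: u_def axis_def)
    qed
  qed
  have u_indep: "c l = 0" if sum0: "(\<Sum>l<p. c l *s u l) = 0" and l: "l < p" for c l
  proof -
    have comp: "(c l' *s u l') $ \<kappa> l = (if l' = l then c l else 0)" if "l' < p" for l'
    proof -
      have "\<kappa> l \<in> K" "\<kappa> l' \<in> K" using \<kappa> l that by (auto simp: bij_betw_def)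
      moreover have "\<kappa> l' = \<kappa> l \<longleftrightarrow> l' = l"
        using \<kappa> l that by (auto simp: bij_betw_def inj_on_eq_iff)
      ultimately show ?thesis
        by (cases "\<kappa> l'"; cases "\<kappa> l") (auto simp: u_def axis_def K_def)
    qed
    have "0 = (\<Sum>l'<p. (c l' *s u l') $ \<kappa> l)"
      using arg_cong[OF sum0, of "\<lambda>x. x $ \<kappa> l"] by (simp only: sum_component zero_index)
    also have "\<dots> = (\<Sum>l'<p. if l' = l then c l else 0)"
      by (rule sum.cong[OF refl]) (simp only: comp lessThan_iff)
    finally show ?thesis using l by simp
  qed
  define v where "v i = (if i = 0 then e else if i = 1 then \<i> *s e else complex_pairs u (i - 2))"
    for i :: nat
  define f where "f y = W y (complex_pairs u)" for y

  obtain B where B: "B \<subseteq> periods" "independent B" "periods \<subseteq> span B"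
    using maximal_independent_subset[of periods] by blast
  then obtain vs where vs: "set vs = B"
    using finite_list[OF independent_imp_finite[OF B(2)]] by blast
  have span_vs: "span (set vs) = span periods"
    using B span_mono[OF B(1)] span_minimal[OF B(3) subspace_span] unfolding vs by blast
  have per: "W (x + w) v = W x v" if "w \<in> set vs" for w x v
    using W_periodic that B(1) unfolding vs by blast
  define F where "F y v = torus_mean vs (\<lambda>x. W x v) y" for y v
  have F_smooth: "smooth_on UNIV (\<lambda>y. F y v)" for v
    unfolding F_def using smooth_torus_mean[OF W_smooth] by simp
  have F_closed: "del (2 * p + 1) (delbar (2 * p) F) x v = 0" for x v
  proof -
    have "delbar (2 * p) F = (\<lambda>y v. torus_mean vs (\<lambda>x. delbar (2 * p) W x v) y)"
      unfolding F_def[abs_def] by (intro ext del_torus_mean(2) W_smooth)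
    then have "del (2 * p + 1) (delbar (2 * p) F) x v
        = torus_mean vs (\<lambda>x. del (2 * p + 1) (delbar (2 * p) W) x v) x"
      by (simp only: del_torus_mean(1)[OF smooth_delbar[OF W_smooth]])
    then show ?thesis by (simp only: W_closed torus_mean_0)
  qed
  have "del (Suc (2 * p)) (delbar (2 * p) F) x v
      = - \<i> / 2 * dir_deriv e (dir_deriv e (\<lambda>y. F y (\<lambda>i. v (i + 2)))) x" for x
  proof (rule del_delbar_of_invariant[where V = "span periods"])
    show "F (x + w) v = F x v" if "w \<in> span periods" for x w v
      unfolding F_def using that span_vs
      by (intro torus_mean_invariant[OF W_smooth]) (auto simp: per)
    show "v i \<in> span periods \<and> \<i> *s v i \<in> span periods" if "i \<ge> 2" for i
    proof -
      have "\<i> *s (\<i> *s x) = - x" for x :: "complex ^ (('n \<times> bool) + ('m \<times> bool))"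
        by (simp add: vec_eq_iff)
      then show ?thesis using that u_span by (auto simp: v_def complex_pairs_def span_neg)
    qed
  qed (use F_smooth \<i>e in \<open>auto simp: v_def\<close>)
  moreover have "(\<lambda>y. F y (\<lambda>i. v (i + 2))) = torus_mean vs f"
    by (simp add: v_def F_def f_def[abs_def])
  ultimately have second: "dir_deriv e (dir_deriv e (torus_mean vs f)) x = 0" for x
    using F_closed[of x v] by simp
  have f_smooth: "smooth_on UNIV f" unfolding f_def[abs_def] by (rule W_smooth)
  have affine: "torus_mean vs f (t *\<^sub>R e)
      = torus_mean vs f 0 + of_real t * dir_deriv e (torus_mean vs f) 0" for t
    by (rule affine_along_line[OF smooth_torus_mean[OF f_smooth] second])

  have "Re (f x) > 0" for x
  proof -
    interpret hermitian_product "G x" by (rule herm)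
    obtain r where "r > 0" "pfaff p (\<lambda>i j. of_real (G x (\<i> *s complex_pairs u i) (complex_pairs u j))) = of_real r"
      using pfaff_positive[of u p] u_indep by blast
    then have "f x = of_real (r / 2 ^ p)" "r / 2 ^ p > 0" by (simp_all add: f_def W_eq)
    then show ?thesis by (simp only: Re_complex_of_real)
  qed
  then have pos: "Re (torus_mean vs f 0) > 0"
    by (intro Re_torus_mean_pos smooth_continuous[OF f_smooth])

  \<comment> \<open>Each \<open>u l\<close> is an eigenvector of the linear part, and the weights of the frame multiply to the inverse
    square of the weight of the omitted position \<open>j0\<close>.\<close>
  have scaling: "f (deck lam (axis i0 (of_int N)) 0 y) = of_real (exp (2 * (lam * of_int N))) * f y" for N y
  proof -
    let ?w = "axis i0 (of_int N)"
    define d where "d l = (case l of Inl i \<Rightarrow> 1 | Inr j \<Rightarrow> exp (if snd j then - (lam * of_int N) else lam * of_int N))"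
      for l :: "('n \<times> bool) + ('m \<times> bool)"
    define c where "c i = d (\<kappa> (i div 2))" for i
    have "exp (phi lam ?w) = of_real (exp (lam * of_int N))"
      by (simp add: i0_def phi_axis exp_of_real[symmetric])
    note rf = rho_factor_eq[OF this]
    have lin_i: "deck_lin lam ?w (\<i> *s x) = \<i> *s deck_lin lam ?w x" for x :: "complex ^ (('n \<times> bool) + ('m \<times> bool))"
      by (auto simp: deck_lin_def vec_eq_iff split: sum.split)
    have comp: "deck_lin lam ?w x $ l' = d l' *\<^sub>R x $ l'" for x l'
      by (cases l') (simp_all add: deck_lin_def d_def rf scaleR_conv_of_real)
    have "d l' = d (\<kappa> l) \<or> u l $ l' = 0" for l l'
      by (cases "\<kappa> l"; cases l') (auto simp: u_def d_def axis_def)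
    then have "deck_lin lam ?w (u l) = d (\<kappa> l) *\<^sub>R u l" for l
      unfolding vec_eq_iff comp vector_scaleR_component by (metis scaleR_zero_right)
    then have lin: "deck_lin lam ?w (complex_pairs u i) = c i *\<^sub>R complex_pairs u i" for i
      by (auto simp: complex_pairs_def c_def lin_i vec_eq_iff)
    have "(?w, 0) \<in> Gam mu P"
      using real_axis_lattice_w zero_in_lattice(2) by (simp add: Gam_def)
    note inv = G_inv[OF this]
    interpret hermitian_product "G (deck lam ?w 0 y)" by (rule herm)
    have "G y (\<i> *s complex_pairs u i) (complex_pairs u j)
        = c i * c j * G (deck lam ?w 0 y) (\<i> *s complex_pairs u i) (complex_pairs u j)" for i j
    proof -
      have "\<i> *s (c i *\<^sub>R complex_pairs u i) = c i *\<^sub>R (\<i> *s complex_pairs u i)" by (simp add: vec_eq_iff)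
      then show ?thesis
        using inv[of y "\<i> *s complex_pairs u i" "complex_pairs u j"]
        by (simp add: lin lin_i bilinear_lmul[OF bil] bilinear_rmul[OF bil] mult_ac)
    qed
    then have "f y = (\<Prod>i<2 * p. complex_of_real (c i)) * f (deck lam ?w 0 y)"
      unfolding f_def W_eq by (simp add: pfaff_rescale)
    moreover have "(\<Prod>i<2 * p. c i) = exp (- (2 * (lam * of_int N)))"
    proof -
      have "(\<Prod>i<2 * p. c i) = (\<Prod>l<p. d (\<kappa> l) * d (\<kappa> l))"
        unfolding prod_pairs[symmetric] by (simp add: c_def)
      also have "\<dots> = (\<Prod>l\<in>K. d l * d l)"
        by (rule prod.reindex_bij_betw[OF \<kappa>])
      also have "\<dots> = (\<Prod>l\<in>K. d l) * (\<Prod>l\<in>K. d l)" by (rule prod.distrib)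
      also have "(\<Prod>l\<in>K. d l) = exp (- (lam * of_int N))"
      proof -
        have "1 = (\<Prod>l\<in>UNIV. d l)" unfolding d_def by (rule prod_fibre_weights[symmetric])
        also have "\<dots> = (\<Prod>l\<in>K. d l) * (\<Prod>l\<in>{Inl i0, Inr j0}. d l)"
          unfolding K_def by (rule prod.subset_diff) auto
        also have "(\<Prod>l\<in>{Inl i0, Inr j0}. d l) = exp (lam * of_int N)"
          by (simp add: d_def j0_def)
        finally show ?thesis by (simp add: exp_minus field_simps)
      qed
      finally show ?thesis by (simp add: exp_add[symmetric])
    qed
    ultimately have "f y = of_real (exp (- (2 * (lam * of_int N)))) * f (deck lam ?w 0 y)"
      by (simp only: of_real_prod[symmetric])
    then show ?thesis by (simp add: exp_minus)
  qed

  have "\<exists>C. \<forall>y\<in>span (set vs). norm (f y) \<le> C"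
    by (rule periodic_bounded_on_span) (simp_all add: smooth_continuous[OF f_smooth], simp add: f_def per)
  then obtain C where C: "\<And>y. y \<in> span periods \<Longrightarrow> norm (f y) \<le> C"
    unfolding span_vs by blast
  have decay: "norm (torus_mean vs f (of_int N *\<^sub>R e)) \<le> C * exp (2 * (lam * of_int N))" for N
  proof (rule norm_torus_mean_le[OF smooth_continuous[OF f_smooth]])
    fix y assume "y \<in> span (set vs)"
    then have y: "y \<in> span periods" by (simp only: span_vs)
    let ?w = "axis i0 (of_int N)"
    define y' where "y' = (\<chi> l. case l of Inl i \<Rightarrow> y $ l | Inr j \<Rightarrow> inverse (rho_factor lam ?w (snd j)) * y $ l)"
    have nz: "rho_factor lam ?w b \<noteq> 0" for b by (simp add: rho_factor_def)
    have "(of_int N *\<^sub>R e + y) $ l = deck lam ?w 0 y' $ l" for l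
    proof (cases l)
      case (Inl i)
      then show ?thesis
        by (simp add: deck_def deck_lin_def y'_def e_def axis_def complex_eq_iff)
    next
      case (Inr j)
      have "e $ l = 0" using Inr by (simp add: e_def axis_def)
      then show ?thesis using nz[of "snd j"] Inr by (simp add: deck_def deck_lin_def y'_def)
    qed
    then have "of_int N *\<^sub>R e + y = deck lam ?w 0 y'" by (simp only: vec_eq_iff) blast
    moreover have "y' \<in> span periods"
    proof -
      have "y' - y \<in> span periods" by (rule vanishing_base_in_span) (simp add: y'_def)
      then show ?thesis using span_add[OF _ y, of "y' - y"] by simp
    qed
    ultimately show "norm (f (of_int N *\<^sub>R e + y)) \<le> C * exp (2 * (lam * of_int N))"
      using C[of y'] by (simp add: scaling norm_mult mult.commute)
  qed

  \<comment> \<open>Going to infinity in the direction \<open>s e\<close> makes the bound \<open>decay\<close> tend to 0.\<close>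
  define s :: int where "s = (if lam > 0 then -1 else 1)"
  have s: "lam * of_int s = - \<bar>lam\<bar>" by (auto simp: s_def)
  have "torus_mean vs f 0 = 0"
  proof (rule affine_decay)
    show "norm (torus_mean vs f 0 + of_nat n * (of_int s * dir_deriv e (torus_mean vs f) 0))
        \<le> C * exp (- (2 * \<bar>lam\<bar>)) ^ n" for n
    proof -
      have "2 * (lam * of_int (int n * s)) = of_nat n * (2 * (lam * of_int s))" by simp
      then have "2 * (lam * of_int (int n * s)) = of_nat n * (- (2 * \<bar>lam\<bar>))"
        unfolding s by simp
      then have "exp (2 * (lam * of_int (int n * s))) = exp (- (2 * \<bar>lam\<bar>)) ^ n"
        by (simp only: exp_of_nat_mult)
      then show ?thesis
        using decay[of "int n * s"] affine[of "of_int (int n * s)"] by (simp add: mult.assoc)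
    qed
  qed (use lam in auto)
  then show False using pos by simp
qed

end

theorem proposition5p2:
  fixes lam :: real
    and M :: "int ^ ('m::finite \<times> bool) ^ ('m \<times> bool)"
    and P :: "real ^ ('m \<times> bool) ^ ('m \<times> bool)"
    and k :: "'n::finite \<times> bool \<Rightarrow> int"
    and mu :: "'n \<times> bool \<Rightarrow> real"
  assumes "lam \<noteq> 0"
    and "det M = 1"
    and "invertible P"
    and "P ** (\<chi> i j. real_of_int (M $ i $ j)) ** matrix_inv P =
           (\<chi> i j. if i = j then (if snd i then exp (- lam) else exp lam) else 0)"
    and "\<And>i. k i \<noteq> 0"
    and "\<And>i. mu i = 2 * real_of_int (k i) * pi / lam"
  shows "\<nexists>g :: (('n, 'm) solv set, ('n \<times> bool) + ('m \<times> bool)) metric.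
           astheno_kaehler (solv_atlas lam mu P) g"
proof -
  interpret solv_lattice lam M P k mu
    by unfold_locales (use assms in auto)
  show ?thesis using not_astheno_kaehler by blast
qed

end
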